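(* Let $T>0$, let $K$ be a radial potential on $\mathbb{R}^d$ with $\nabla K\in W^{1,\infty}(\mathbb{R}^d)$, and let $f_0\in\mathcal{P}_1(\mathbb{R}^d\times\mathbb{R}^d)$ have compact support. For $\epsilon>0$ let $f_\epsilon$ be the measure-valued solution of $$\partial_t f_\epsilon+v\cdot\nabla_x f_\epsilon=\frac1\epsilon\nabla_v\cdot\big((v+\nabla_xK\ast\rho_\epsilon)f_\epsilon\big),\qquad f_\epsilon|_{t=0}=f_0,$$ with first marginal $\rho_\epsilon$, and let $\rho$ be the limiting macroscopic density, $\rho_\epsilon(t,\cdot)\to\rho(t,\cdot)$ in $W_1$ as $\epsilon\to0$. Let $(x_0,v_0)\in\operatorname{supp}f_0$ and let $(x_\epsilon(t),v_\epsilon(t))$ be the characteristic path solving $$\frac{dx}{dt}=v,\qquad\epsilon\frac{dv}{dt}=-v-\nabla_xK\ast\rho_\epsilon(t,x),\qquad (x,v)|_{t=0}=(x_0,v_0).$$ Then $$\lim_{\epsilon\to0}x_\epsilon(t)=x(t)\quad\text{for all }0\le t\le T,$$ where $x(t)$ is the characteristic trajectory of the limiting macroscopic equation that starts at $x_0$, i.e. $$\frac{dx}{dt}=-\nabla_xK\ast\rho(t,x),\qquad x(0)=x_0.$$ Also, $$\lim_{\epsilon\to0}v_\epsilon(t)=v(t)\quad\text{for all }0<t\le T,\qquad\text{where } v(t)=-\nabla_xK\ast\rho(t,x(t)).$$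
   Context: Convention: $\int\varphi(x)\mu(x)\,dx$ denotes the integral of $\varphi$ against the measure $\mu$. $\mathcal{P}_1(\mathbb{R}^k)$ is the set of Borel probability measures on $\mathbb{R}^k$ with finite first moment, endowed with the $1$-Wasserstein distance $W_1$. The first marginal $\rho$ of $f$ is defined by $\int_{\mathbb{R}^d}\tilde\psi(x)\rho(t,x)\,dx=\iint\tilde\psi(x)f(t,x,v)\,dx\,dv$ for all $\tilde\psi\in C_b(\mathbb{R}^d)$. "Radial" means that $K(x)$ depends only on $|x|$. Measure-valued solution of the kinetic equation (for fixed $\epsilon>0$): for a continuous vector field $E(t,x)$ on $[0,T]\times\mathbb{R}^d$, locally Lipschitz in $x$ and with $|E(t,x)|\le C(1+|x|)$ for some $C>0$, let $\mathcal{T}^{t,\epsilon}_E:(x_0,v_0)\mapsto(x(t),v(t))$ be the flow map of $\frac{dx}{dt}=v$, $\frac{dv}{dt}=-\frac1\epsilon v+\frac1\epsilon E(t,x)$, $(x,v)(0)=(x_0,v_0)$. For $f:[0,T]\to\mathcal{P}_1(\mathbb{R}^d\times\mathbb{R}^d)$ with first marginal $\rho$ put $E[f]=-\nabla K\ast\rho$. Then $f$ is a solution with initial condition $f_0$ if $E[f]$ is locally Lipschitz in $x$ and satisfies $|E[f](t,x)|\le C(1+|x|)$ on $[0,T]\times\mathbb{R}^d$ for some $C>0$, and $f(t)=\mathcal{T}^{t,\epsilon}_{E[f]}\#f_0$ (push-forward) for all $t$. It is known (Cañizo–Carrillo–Rosado) that for compactly supported $f_0\in\mathcal{P}_1(\mathbb{R}^d\times\mathbb{R}^d)$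 there is a unique solution $f_\epsilon\in C([0,\infty);\mathcal{P}_1(\mathbb{R}^d\times\mathbb{R}^d))$ in this sense whose support is contained, for $t\in[0,T]$, in a ball $B_{R_\epsilon(T)}$ with $R_\epsilon$ increasing; $f_\epsilon$ is this solution. Limiting density: for every $t\ge0$ the $W_1$-limit $\rho(t,\cdot)=\lim_{\epsilon\to0}\rho_\epsilon(t,\cdot)$ exists in $\mathcal{P}_1(\mathbb{R}^d)$; $\rho$ is $W_1$-continuous in time, and on every interval $[0,T)$ it is the unique weak solution of the macroscopic equation $\rho_t-\nabla_x\cdot((\nabla_xK\ast\rho)\rho)=0$, $\rho|_{t=0}=\rho_0$, with $\rho_0$ the first marginal of $f_0$ (weak: tested against all $\psi\in C^1_c([0,T);C^1_b(\mathbb{R}^d))$, among narrowly continuous curves of probability measures). *)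

theory Defs
  imports "HOL-Probability.Probability"
begin

definition P1 :: "'a::euclidean_space measure set" where
  "P1 = {M. prob_space M \<and> sets M = sets borel \<and> integrable M norm}"

definition couplings ::
  "'a::euclidean_space measure \<Rightarrow> 'a measure \<Rightarrow> ('a \<times> 'a) measure set" where
  "couplings \<mu> \<nu> =
    {\<pi>. sets \<pi> = sets borel \<and> distr \<pi> borel fst = \<mu> \<and> distr \<pi> borel snd = \<nu>}"

definition W1 :: "'a::euclidean_space measure \<Rightarrow> 'a measure \<Rightarrow> ennreal" where
  "W1 \<mu> \<nu> = (INF \<pi>\<in>couplings \<mu> \<nu>. \<integral>\<^sup>+ z. ennreal (dist (fst z) (snd z)) \<partial>\<pi>)"

definition W1_continuous_on :: "real set \<Rightarrow> (real \<Rightarrow> 'a::euclidean_space measure) \<Rightarrow> bool" where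
  "W1_continuous_on S \<mu> \<longleftrightarrow> (\<forall>s\<in>S. ((\<lambda>t. W1 (\<mu> t) (\<mu> s)) \<longlongrightarrow> 0) (at s within S))"

definition msupport :: "'a::topological_space measure \<Rightarrow> 'a set" where
  "msupport M = {x. \<forall>U. open U \<longrightarrow> x \<in> U \<longrightarrow> emeasure M U > 0}"

definition marginal1 :: "('a::euclidean_space \<times> 'a) measure \<Rightarrow> 'a measure" where
  "marginal1 M = distr M borel fst"

definition loc_integrable :: "('a::euclidean_space \<Rightarrow> 'b::euclidean_space) \<Rightarrow> bool" where
  "loc_integrable u \<longleftrightarrow> (\<forall>S. compact S \<longrightarrow> set_integrable lebesgue S u)"

text \<open>Test functions are of class \<open>C\<^sup>1\<close> with compact support, as in Gilbarg and Trudinger;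
  the gradient is carried along as a second argument.\<close>

definition test_function :: "('a::euclidean_space \<Rightarrow> real) \<Rightarrow> ('a \<Rightarrow> 'a) \<Rightarrow> bool" where
  "test_function \<phi> D\<phi> \<longleftrightarrow>
    (\<forall>x. GDERIV \<phi> x :> D\<phi> x) \<and> continuous_on UNIV D\<phi> \<and> compact (closure {x. \<phi> x \<noteq> 0})"

definition weak_partial ::
  "'a::euclidean_space \<Rightarrow> ('a \<Rightarrow> 'b::euclidean_space) \<Rightarrow> ('a \<Rightarrow> 'b) \<Rightarrow> bool" where
  "weak_partial b u w \<longleftrightarrow> loc_integrable u \<and> loc_integrable w \<and>
    (\<forall>\<phi> D\<phi>. test_function \<phi> D\<phi> \<longrightarrow>
      (\<integral>x. (D\<phi> x \<bullet> b) *\<^sub>R u x \<partial>lebesgue) = - (\<integral>x. \<phi> x *\<^sub>R w x \<partial>lebesgue))"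

definition weak_gradient :: "('a::euclidean_space \<Rightarrow> real) \<Rightarrow> ('a \<Rightarrow> 'a) \<Rightarrow> bool" where
  "weak_gradient u G \<longleftrightarrow> (\<forall>b\<in>Basis. weak_partial b u (\<lambda>x. G x \<bullet> b))"

definition L_infty :: "('a::euclidean_space \<Rightarrow> 'b::euclidean_space) set" where
  "L_infty = {g \<in> borel_measurable lebesgue. \<exists>C. AE x in lebesgue. norm (g x) \<le> C}"

definition W_1_infty :: "('a::euclidean_space \<Rightarrow> 'b::euclidean_space) set" where
  "W_1_infty = {g \<in> L_infty. \<forall>b\<in>Basis. \<exists>w\<in>L_infty. weak_partial b g w}"

text \<open>\<open>\<nabla>K\<close> is convolved with measures that may have atoms, so it has to be a function defined at
  every point: the continuous representative of the distributional gradient of \<open>K\<close>, which exists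
  and is unique when that gradient lies in \<open>W\<^sup>1\<^sup>,\<^sup>\<infinity>\<close>.\<close>

definition potential_gradient :: "('a::euclidean_space \<Rightarrow> real) \<Rightarrow> ('a \<Rightarrow> 'a) \<Rightarrow> bool" where
  "potential_gradient K gradK \<longleftrightarrow> weak_gradient K gradK \<and> continuous_on UNIV gradK"

definition radial :: "('a::euclidean_space \<Rightarrow> real) \<Rightarrow> bool" where
  "radial K \<longleftrightarrow> (\<forall>x y. norm x = norm y \<longrightarrow> K x = K y)"

definition conv_measure ::
  "('a::euclidean_space \<Rightarrow> 'a) \<Rightarrow> 'a measure \<Rightarrow> 'a \<Rightarrow> 'a" where
  "conv_measure G \<mu> x = (\<integral>y. G (x - y) \<partial>\<mu>)"

definition admissible_field :: "real \<Rightarrow> (real \<Rightarrow> 'a::euclidean_space \<Rightarrow> 'a) \<Rightarrow> bool" where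
  "admissible_field T E \<longleftrightarrow>
    continuous_on ({0..T} \<times> UNIV) (\<lambda>(t, x). E t x) \<and>
    local_lipschitz {0..T} UNIV E \<and>
    (\<exists>C>0. \<forall>t\<in>{0..T}. \<forall>x. norm (E t x) \<le> C * (1 + norm x))"

definition kinetic_path ::
  "real \<Rightarrow> real \<Rightarrow> (real \<Rightarrow> 'a::euclidean_space \<Rightarrow> 'a) \<Rightarrow> 'a \<times> 'a
    \<Rightarrow> (real \<Rightarrow> 'a) \<Rightarrow> (real \<Rightarrow> 'a) \<Rightarrow> bool" where
  "kinetic_path \<epsilon> T E z0 x v \<longleftrightarrow> (x 0, v 0) = z0 \<and>
    (\<forall>t\<in>{0..T}.
      (x has_vector_derivative v t) (at t within {0..T}) \<and>
      (v has_vector_derivative (- (1 / \<epsilon>) *\<^sub>R v t + (1 / \<epsilon>) *\<^sub>R E t (x t))) (at t within {0..T}))"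

definition kinetic_flow ::
  "real \<Rightarrow> real \<Rightarrow> (real \<Rightarrow> 'a::euclidean_space \<Rightarrow> 'a)
    \<Rightarrow> (real \<Rightarrow> 'a \<times> 'a \<Rightarrow> 'a \<times> 'a) \<Rightarrow> bool" where
  "kinetic_flow \<epsilon> T E \<Phi> \<longleftrightarrow>
    (\<forall>z0. kinetic_path \<epsilon> T E z0 (\<lambda>t. fst (\<Phi> t z0)) (\<lambda>t. snd (\<Phi> t z0)))"

definition kinetic_solution ::
  "('a::euclidean_space \<Rightarrow> 'a) \<Rightarrow> real \<Rightarrow> real \<Rightarrow> ('a \<times> 'a) measure
    \<Rightarrow> (real \<Rightarrow> ('a \<times> 'a) measure) \<Rightarrow> bool" where
  "kinetic_solution gradK \<epsilon> T f0 f \<longleftrightarrow>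
    (\<forall>t\<in>{0..T}. f t \<in> P1) \<and> W1_continuous_on {0..T} f \<and>
    (let E = (\<lambda>t x. - conv_measure gradK (marginal1 (f t)) x) in
      admissible_field T E \<and>
      (\<exists>\<Phi>. kinetic_flow \<epsilon> T E \<Phi> \<and> (\<forall>t\<in>{0..T}. f t = distr f0 borel (\<Phi> t))))"

definition macro_path ::
  "real \<Rightarrow> (real \<Rightarrow> 'a::euclidean_space \<Rightarrow> 'a) \<Rightarrow> 'a \<Rightarrow> (real \<Rightarrow> 'a) \<Rightarrow> bool" where
  "macro_path T E x0 x \<longleftrightarrow> x 0 = x0 \<and>
    (\<forall>t\<in>{0..T}. (x has_vector_derivative E t (x t)) (at t within {0..T}))"

end

theory Submission
  imports Defs
begin

text \<open>
  Friction dominates inertia as \<open>\<epsilon> \<rightarrow> 0\<close>. Adding the equations \<open>x' = v\<close> and \<open>\<epsilon> v' = - v + E\<close>, where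
  \<open>E = - \<nabla>K * \<rho>\<close>, gives \<open>(x + \<epsilon> v)' = E\<close>, and the velocity stays bounded by \<open>\<bar>v0\<bar> + sup \<bar>\<nabla>K\<bar>\<close> whatever \<open>\<epsilon>\<close> is.
  So \<open>x + \<epsilon> v\<close> is within \<open>O(\<epsilon>)\<close> of \<open>x\<close> and follows the field at a point close to its own position.
  It can therefore be compared by Gronwall's inequality with the macroscopic trajectory, provided that
  the fields \<open>E\<^sub>\<epsilon>\<close> converge, uniformly in time, along that trajectory. The velocity equation, solved by
  the weight \<open>exp (t / \<epsilon>)\<close>, shows that \<open>v t\<close> equals the field at the current position up to \<open>O(\<epsilon>)\<close> and a
  contribution of the initial layer that dies out for \<open>t > 0\<close>. This part concerns one particle
  in a prescribed field; it is the lemma \<open>small_inertia_limit\<close>.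

  The rest supplies the bounds, uniform in \<open>\<epsilon>\<close>, that it assumes. First, \<open>\<nabla>K\<close> is bounded and Lipschitz,
  being the continuous representative of a function in \<open>W\<^sup>1\<^sup>,\<^sup>\<infinity>\<close>. This is shown by
  testing the weak derivatives against bumps whose centre moves along a segment
  (\<open>continuous_W_1_infty_imp_lipschitz\<close>). Hence the fields are bounded and Lipschitz in space, and
  \<open>\<bar>E\<^sub>\<epsilon> - E\<bar> \<le> L W\<^sub>1(\<rho>\<^sub>\<epsilon>, \<rho>)\<close> (\<open>conv_measure_diff_le_W1\<close>), so they converge at each time. Convergence at
  each time becomes uniform because the fields are also Lipschitz in time, with a constant that does
  not depend on \<open>\<epsilon>\<close>: the density is transported by a flow whose mean speed is bounded by the first moment of
  the initial velocities plus \<open>sup \<bar>\<nabla>K\<bar>\<close> (\<open>kinetic_field_time_lipschitz\<close>). The same estimate makes the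
  forcing in the velocity equation Lipschitz, which the \<open>O(\<epsilon>)\<close> relaxation error requires.
\<close>

section \<open>Differential inequalities and uniform convergence\<close>

text \<open>The mean value inequality with a comparison function, in the form in which paths on \<open>[0,T]\<close> are
given: derivatives are taken within a larger set, which covers the endpoints.\<close>

lemma norm_increment_le_of_derivative_le:
  fixes f :: "real \<Rightarrow> 'a::real_normed_vector" and \<phi> :: "real \<Rightarrow> real"
  assumes "a \<le> b" "{a..b} \<subseteq> S"
    and f: "\<And>t. t \<in> S \<Longrightarrow> (f has_vector_derivative f' t) (at t within S)"
    and \<phi>: "\<And>t. t \<in> S \<Longrightarrow> (\<phi> has_real_derivative \<phi>' t) (at t within S)"
    and le: "\<And>t. t \<in> {a..b} \<Longrightarrow> norm (f' t) \<le> \<phi>' t"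
  shows "norm (f b - f a) \<le> \<phi> b - \<phi> a"
proof (cases "a = b")
  case False
  have f2: "(f has_vector_derivative f' t) (at t within {a..b})" if "t \<in> {a..b}" for t
    using that f assms(2) has_vector_derivative_within_subset by blast
  have \<phi>2: "(\<phi> has_vector_derivative \<phi>' t) (at t within {a..b})" if "t \<in> {a..b}" for t
    using that \<phi> assms(2) has_vector_derivative_within_subset
    unfolding has_real_derivative_iff_has_vector_derivative by blast
  show ?thesis
  proof (rule differentiable_bound_general)
    show "a < b" using False assms(1) by simp
    show "continuous_on {a..b} f"
      using f2 has_vector_derivative_continuous continuous_on_eq_continuous_within by blast
    show "continuous_on {a..b} \<phi>"
      using \<phi>2 has_vector_derivative_continuous continuous_on_eq_continuous_within by blast
    show "(f has_vector_derivative f' t) (at t)" if "a < t" "t < b" for t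
      using f2[of t] that by (simp add: at_within_Icc_at)
    show "(\<phi> has_vector_derivative \<phi>' t) (at t)" if "a < t" "t < b" for t
      using \<phi>2[of t] that by (simp add: at_within_Icc_at)
  qed (use le in auto)
qed auto

text \<open>The scalar \<open>\<bar>p\<bar>\<^sup>2\<close> is differentiable even where \<open>p\<close> vanishes, and Young's inequality absorbs
the inhomogeneity: \<open>(\<bar>p\<bar>\<^sup>2)' \<le> 2 C \<bar>p\<bar>\<^sup>2 + 2 \<eta> \<bar>p\<bar> \<le> (2 C + 1) \<bar>p\<bar>\<^sup>2 + \<eta>\<^sup>2\<close>. This is where the exponent
\<open>2 C + 1\<close> comes from.\<close>

lemma gronwall_norm:
  fixes p :: "real \<Rightarrow> 'a::real_inner"
  assumes C: "C \<ge> 0" and \<eta>: "\<eta> \<ge> 0"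
    and p: "\<And>t. t \<in> {0..T} \<Longrightarrow> (p has_vector_derivative p' t) (at t within {0..T})"
    and le: "\<And>t. t \<in> {0..T} \<Longrightarrow> norm (p' t) \<le> C * norm (p t) + \<eta>"
    and t: "t \<in> {0..T}"
  shows "(norm (p t))\<^sup>2 \<le> ((norm (p 0))\<^sup>2 + \<eta>\<^sup>2 * t) * exp ((2 * C + 1) * t)"
proof -
  define k where "k = 2 * C + 1"
  define q where "q s = exp (- k * s) * (p s \<bullet> p s) - \<eta>\<^sup>2 * s" for s
  define q' where "q' s = exp (- k * s) * (2 * (p s \<bullet> p' s)) - k * exp (- k * s) * (p s \<bullet> p s) - \<eta>\<^sup>2" for s
  have inner: "((\<lambda>s. p s \<bullet> p s) has_real_derivative 2 * (p s \<bullet> p' s)) (at s within {0..T})"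
    if "s \<in> {0..T}" for s
    using p[OF that] unfolding has_field_derivative_def has_vector_derivative_def
    by (auto intro!: derivative_eq_intros ext simp: inner_commute algebra_simps)
  have q: "(q has_real_derivative q' s) (at s within {0..T})" if "s \<in> {0..T}" for s
    unfolding q_def q'_def by (rule derivative_eq_intros inner[OF that] refl | simp)+
  have q'_le: "q' s \<le> 0" if s: "s \<in> {0..T}" for s
  proof -
    have "2 * (p s \<bullet> p' s) \<le> 2 * (norm (p s) * (C * norm (p s) + \<eta>))"
      using norm_cauchy_schwarz[of "p s" "p' s"] mult_left_mono[OF le[OF s], of "norm (p s)"] by auto
    also have "\<dots> \<le> k * (norm (p s))\<^sup>2 + \<eta>\<^sup>2"
      using sum_squares_bound[of "norm (p s)" \<eta>] by (simp add: k_def algebra_simps power2_eq_square)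
    finally have *: "2 * (p s \<bullet> p' s) \<le> k * (p s \<bullet> p s) + \<eta>\<^sup>2"
      by (simp add: power2_norm_eq_inner)
    have "k * s \<ge> 0" using C s by (simp add: k_def)
    then have "exp (- k * s) \<le> 1" by simp
    then have "exp (- k * s) * \<eta>\<^sup>2 \<le> \<eta>\<^sup>2"
      using mult_right_mono[of "exp (- k * s)" 1 "\<eta>\<^sup>2"] by simp
    moreover have "exp (- k * s) * (2 * (p s \<bullet> p' s)) \<le> exp (- k * s) * (k * (p s \<bullet> p s) + \<eta>\<^sup>2)"
      using * by (intro mult_left_mono) auto
    ultimately show ?thesis by (simp add: q'_def algebra_simps)
  qed
  have "q t \<le> q 0"
  proof (rule DERIV_nonpos_imp_decreasing_open[of 0 t q])
    show "0 \<le> t" using t by simp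
    show "\<exists>y. DERIV q s :> y \<and> y \<le> 0" if "0 < s" "s < t" for s
      using q[of s] q'_le[of s] that t at_within_Icc_at[of 0 s T] by auto
    have "continuous_on {0..T} q"
      using q DERIV_continuous continuous_on_eq_continuous_within by blast
    then show "continuous_on {0..t} q" by (rule continuous_on_subset) (use t in auto)
  qed
  then have "exp (k * t) * (exp (- k * t) * (norm (p t))\<^sup>2) \<le> exp (k * t) * ((norm (p 0))\<^sup>2 + \<eta>\<^sup>2 * t)"
    by (intro mult_left_mono) (auto simp: q_def power2_norm_eq_inner)
  then show ?thesis
    unfolding k_def[symmetric] by (simp add: mult.assoc[symmetric] exp_add[symmetric] mult.commute)
qed

text \<open>Pointwise convergence on a finite \<open>e / (4 \<Lambda>)\<close>-net spreads to all of \<open>S\<close>, since neither \<open>F i\<close> nor its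
limit moves by more than \<open>e / 4\<close> between a point and its neighbour in the net. A filter
takes the place of a sequence because \<open>\<epsilon>\<close> tends to 0 through all positive reals.\<close>

lemma uniform_limit_if_equi_lipschitz:
  fixes F :: "'i \<Rightarrow> real \<Rightarrow> 'b::metric_space"
  assumes S: "compact S"
    and lip: "eventually (\<lambda>i. \<forall>s\<in>S. \<forall>t\<in>S. dist (F i s) (F i t) \<le> \<Lambda> * dist s t) I"
    and lim: "\<And>s. s \<in> S \<Longrightarrow> ((\<lambda>i. F i s) \<longlongrightarrow> G s) I"
    and "\<Lambda> > 0" "I \<noteq> bot"
  shows "uniform_limit S F G I"
proof (rule uniform_limitI)
  fix e :: real assume e: "e > 0"
  define d where "d = e / (4 * \<Lambda>)"
  have d: "d > 0" and \<Lambda>d: "\<Lambda> * d = e / 4" using e \<open>\<Lambda> > 0\<close> by (auto simp: d_def)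
  have G: "dist (G s) (G t) \<le> \<Lambda> * dist s t" if "s \<in> S" "t \<in> S" for s t
    by (rule tendsto_upperbound[OF tendsto_dist[OF lim lim]])
      (use that \<open>I \<noteq> bot\<close> in \<open>auto intro: eventually_mono[OF lip]\<close>)
  obtain N where N: "finite N" "N \<subseteq> S" "S \<subseteq> (\<Union>s\<in>N. ball s d)"
    using compactE_image[OF S, of S "\<lambda>s. ball s d"] d by (metis UN_I centre_in_ball open_ball subsetI)
  have "eventually (\<lambda>i. \<forall>s\<in>N. dist (F i s) (G s) < e / 4) I"
    using N e by (intro eventually_ball_finite ballI tendstoD[OF lim]) auto
  with lip show "\<forall>\<^sub>F i in I. \<forall>s\<in>S. dist (F i s) (G s) < e"
  proof eventually_elim
    case (elim i)
    show ?case
    proof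
      fix s assume s: "s \<in> S"
      then obtain t where t: "t \<in> N" "dist t s < d" using N by auto
      have "\<Lambda> * dist t s \<le> e / 4"
        using t \<open>\<Lambda> > 0\<close> mult_left_mono[of "dist t s" d \<Lambda>] by (simp add: \<Lambda>d)
      moreover have "dist (F i s) (F i t) \<le> \<Lambda> * dist s t" "dist (G t) (G s) \<le> \<Lambda> * dist t s"
        using elim(1) G s t N by auto
      moreover have "dist (F i t) (G t) < e / 4" using elim t by auto
      moreover have "dist (F i s) (G s) \<le> dist (F i s) (F i t) + dist (F i t) (G t) + dist (G t) (G s)"
        using dist_triangle[of "F i s" "G s" "F i t"] dist_triangle[of "F i t" "G s" "G t"] by simp
      ultimately show "dist (F i s) (G s) < e" using e by (simp add: dist_commute)
    qed
  qed
qed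

section \<open>Kinetic paths and flows\<close>

lemma kinetic_pathD:
  assumes "kinetic_path \<epsilon> T E z0 x v"
  shows "x 0 = fst z0" "v 0 = snd z0"
    and "\<And>t. t \<in> {0..T} \<Longrightarrow> (x has_vector_derivative v t) (at t within {0..T})"
    and "\<And>t. t \<in> {0..T} \<Longrightarrow>
      (v has_vector_derivative (1 / \<epsilon>) *\<^sub>R (E t (x t) - v t)) (at t within {0..T})"
  using assms by (auto simp: kinetic_path_def algebra_simps)

text \<open>The equation \<open>\<epsilon> v' = h - v\<close> forgets its initial value after a time of order \<open>\<epsilon>\<close>, so \<open>v t\<close> sees only the
most recent values of the forcing. Multiplied by \<open>exp (s / \<epsilon>)\<close> the equation for \<open>v - c\<close> becomes
\<open>w' = (exp (s / \<epsilon>) / \<epsilon>) (h - c)\<close>, and the bound on \<open>h - c\<close> times the same weight has the explicit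
primitive \<open>\<psi>\<close>, so that no integral has to be evaluated. The case \<open>\<Lambda> = 0\<close> bounds the speed of a
kinetic path; the case \<open>m = 0\<close> locates the velocity near the field.\<close>

lemma exponential_relaxation_bound:
  fixes v h :: "real \<Rightarrow> 'a::real_normed_vector"
  assumes \<epsilon>: "\<epsilon> > 0"
    and v: "\<And>s. s \<in> {0..T} \<Longrightarrow> (v has_vector_derivative (1 / \<epsilon>) *\<^sub>R (h s - v s)) (at s within {0..T})"
    and h: "\<And>s. s \<in> {0..t} \<Longrightarrow> norm (h s - c) \<le> m + \<Lambda> * (t - s)"
    and t: "t \<in> {0..T}" and \<Lambda>: "\<Lambda> \<ge> 0" and m: "m \<ge> 0"
  shows "norm (v t - c) \<le> exp (- t / \<epsilon>) * norm (v 0 - c) + m + \<Lambda> * \<epsilon>"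
proof -
  define w where "w s = exp (s / \<epsilon>) *\<^sub>R (v s - c)" for s
  define w' where "w' s = (exp (s / \<epsilon>) / \<epsilon>) *\<^sub>R (h s - c)" for s
  define \<psi> where "\<psi> s = exp (s / \<epsilon>) * (m + \<Lambda> * (t - s) + \<Lambda> * \<epsilon>)" for s
  define \<psi>' where "\<psi>' s = (exp (s / \<epsilon>) / \<epsilon>) * (m + \<Lambda> * (t - s))" for s
  have exp': "((\<lambda>s. exp (s / \<epsilon>)) has_real_derivative exp (s / \<epsilon>) / \<epsilon>) (at s within {0..T})" for s
    using \<epsilon> by (auto intro!: derivative_eq_intros)
  have "norm (w t - w 0) \<le> \<psi> t - \<psi> 0"
  proof (rule norm_increment_le_of_derivative_le)
    show "0 \<le> t" "{0..t} \<subseteq> {0..T}" using t by auto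
    show "(w has_vector_derivative w' s) (at s within {0..T})" if "s \<in> {0..T}" for s
    proof -
      have "((\<lambda>s. v s - c) has_vector_derivative (1 / \<epsilon>) *\<^sub>R (h s - v s)) (at s within {0..T})"
        using has_vector_derivative_diff[OF v[OF that] has_vector_derivative_const[of c]] by simp
      from has_vector_derivative_scaleR[OF exp' this]
      show ?thesis
        unfolding w_def w'_def by (simp add: algebra_simps)
    qed
    show "(\<psi> has_real_derivative \<psi>' s) (at s within {0..T})" if "s \<in> {0..T}" for s
      unfolding \<psi>_def \<psi>'_def using \<epsilon>
      by (auto intro!: derivative_eq_intros exp' simp: field_simps)
    show "norm (w' s) \<le> \<psi>' s" if "s \<in> {0..t}" for s
      using h[OF that] \<epsilon> by (simp add: w'_def \<psi>'_def divide_right_mono)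
  qed
  moreover have "\<psi> 0 \<ge> 0" using \<epsilon> \<Lambda> t m by (simp add: \<psi>_def)
  ultimately have "norm (w t) \<le> norm (w 0) + \<psi> t"
    using norm_triangle_sub[of "w t" "w 0"] by linarith
  then have "exp (t / \<epsilon>) * norm (v t - c) \<le> norm (v 0 - c) + exp (t / \<epsilon>) * (m + \<Lambda> * \<epsilon>)"
    by (simp add: w_def \<psi>_def)
  then have "exp (- t / \<epsilon>) * (exp (t / \<epsilon>) * norm (v t - c))
      \<le> exp (- t / \<epsilon>) * (norm (v 0 - c) + exp (t / \<epsilon>) * (m + \<Lambda> * \<epsilon>))"
    by (intro mult_left_mono) auto
  then show ?thesis
    by (simp add: distrib_left mult.assoc[symmetric] exp_add[symmetric])
qed

lemma kinetic_path_speed: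
  assumes path: "kinetic_path \<epsilon> T E z0 x v" and \<epsilon>: "\<epsilon> > 0"
    and E: "\<And>t y. t \<in> {0..T} \<Longrightarrow> norm (E t y) \<le> M" and t: "t \<in> {0..T}"
  shows "norm (v t) \<le> norm (snd z0) + M"
proof -
  have M: "M \<ge> 0" using E[OF t, of undefined] norm_ge_zero order_trans by blast
  have "norm (v t - 0) \<le> exp (- t / \<epsilon>) * norm (v 0 - 0) + M + 0 * \<epsilon>"
    by (rule exponential_relaxation_bound[OF \<epsilon> kinetic_pathD(4)[OF path]])
      (use E t M in auto)
  moreover have "exp (- t / \<epsilon>) * norm (v 0) \<le> norm (v 0)"
    using t \<epsilon> mult_right_mono[of "exp (- t / \<epsilon>)" 1 "norm (v 0)"] by simp
  ultimately show ?thesis using kinetic_pathD(2)[OF path] by simp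
qed

text \<open>The Lipschitz constant does not involve \<open>\<epsilon>\<close>: friction caps the speed by the initial speed plus the
size of the field. This is the source of all uniformity in the limit.\<close>

lemma kinetic_path_lipschitz:
  assumes path: "kinetic_path \<epsilon> T E z0 x v" and \<epsilon>: "\<epsilon> > 0"
    and E: "\<And>t y. t \<in> {0..T} \<Longrightarrow> norm (E t y) \<le> M" and s: "s \<in> {0..T}" and t: "t \<in> {0..T}"
  shows "norm (x t - x s) \<le> (norm (snd z0) + M) * \<bar>t - s\<bar>"
proof -
  have *: "norm (x b - x a) \<le> (norm (snd z0) + M) * b - (norm (snd z0) + M) * a"
    if "a \<le> b" "{a..b} \<subseteq> {0..T}" for a b
    by (rule norm_increment_le_of_derivative_le[OF that kinetic_pathD(3)[OF path]])
      (use kinetic_path_speed[OF path \<epsilon> E] that in \<open>auto intro!: derivative_eq_intros\<close>)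
  show ?thesis
    using *[of s t] *[of t s] s t
    by (cases "s \<le> t") (auto simp: norm_minus_commute algebra_simps)
qed

text \<open>A flow is given pointwise, as a family of paths, so the measurability that its push-forward
requires has to be derived. The Gronwall inequality for the difference of two paths in phase space
gives Lipschitz dependence on the initial point.\<close>

lemma kinetic_flow_continuous:
  fixes E :: "real \<Rightarrow> 'a::euclidean_space \<Rightarrow> 'a"
  assumes flow: "kinetic_flow \<epsilon> T E \<Phi>" and \<epsilon>: "\<epsilon> > 0"
    and E: "\<And>t y z. t \<in> {0..T} \<Longrightarrow> norm (E t y - E t z) \<le> L * norm (y - z)"
    and L: "L \<ge> 0" and t: "t \<in> {0..T}"
  shows "continuous_on UNIV (\<Phi> t)"
proof -
  define C where "C = 1 + (1 + L) / \<epsilon>"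
  have C: "C \<ge> 0" using \<epsilon> L by (simp add: C_def)
  have bound: "(norm (\<Phi> t z - \<Phi> t z'))\<^sup>2 \<le> (norm (z - z'))\<^sup>2 * exp ((2 * C + 1) * t)" for z z'
  proof -
    define E' where "E' s z = E s (fst (\<Phi> s z))" for s z
    have path: "kinetic_path \<epsilon> T E z (\<lambda>t. fst (\<Phi> t z)) (\<lambda>t. snd (\<Phi> t z))" for z
      using flow unfolding kinetic_flow_def by blast
    note D = kinetic_pathD[OF path]
    have der: "((\<lambda>s. \<Phi> s z) has_vector_derivative
        (snd (\<Phi> s z), (1 / \<epsilon>) *\<^sub>R (E' s z - snd (\<Phi> s z)))) (at s within {0..T})"
      if "s \<in> {0..T}" for s z
      using has_vector_derivative_Pair[OF D(3)[OF that, of z] D(4)[OF that, of z]] by (simp add: E'_def)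
    have init: "\<Phi> 0 z = z" for z using D(1)[of z] D(2)[of z] by (simp add: prod_eq_iff)
    have "(norm (\<Phi> t z - \<Phi> t z'))\<^sup>2
        \<le> ((norm (\<Phi> 0 z - \<Phi> 0 z'))\<^sup>2 + 0\<^sup>2 * t) * exp ((2 * C + 1) * t)"
    proof (rule gronwall_norm[OF C order_refl has_vector_derivative_diff[OF der der] _ t])
      fix s assume s: "s \<in> {0..T}"
      let ?dx = "fst (\<Phi> s z - \<Phi> s z')" and ?dv = "snd (\<Phi> s z - \<Phi> s z')"
      have n: "norm ?dx \<le> norm (\<Phi> s z - \<Phi> s z')" "norm ?dv \<le> norm (\<Phi> s z - \<Phi> s z')"
        by (metis norm_fst_le prod.collapse, metis norm_snd_le prod.collapse)
      have "norm ((snd (\<Phi> s z), (1 / \<epsilon>) *\<^sub>R (E' s z - snd (\<Phi> s z))) -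
          (snd (\<Phi> s z'), (1 / \<epsilon>) *\<^sub>R (E' s z' - snd (\<Phi> s z'))))
        = norm (?dv, (1 / \<epsilon>) *\<^sub>R ((E' s z - E' s z') - ?dv))"
        by (simp add: algebra_simps)
      also have "\<dots> \<le> norm ?dv + norm ((1 / \<epsilon>) *\<^sub>R ((E' s z - E' s z') - ?dv))"
        by (rule norm_Pair_le)
      also have "norm ((1 / \<epsilon>) *\<^sub>R ((E' s z - E' s z') - ?dv))
          \<le> (1 / \<epsilon>) * (L * norm ?dx + norm ?dv)"
      proof -
        have "norm ((E' s z - E' s z') - ?dv) \<le> L * norm ?dx + norm ?dv"
          using norm_triangle_ineq4[of "E' s z - E' s z'" ?dv] E[OF s, of "fst (\<Phi> s z)" "fst (\<Phi> s z')"]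
          by (simp add: E'_def)
        then show ?thesis using \<epsilon> by (simp add: divide_right_mono)
      qed
      also have "\<dots> \<le> (1 / \<epsilon>) * (L * norm (\<Phi> s z - \<Phi> s z') + norm (\<Phi> s z - \<Phi> s z'))"
        using n L \<epsilon> by (intro mult_left_mono add_mono) auto
      finally show "norm ((snd (\<Phi> s z), (1 / \<epsilon>) *\<^sub>R (E' s z - snd (\<Phi> s z))) -
          (snd (\<Phi> s z'), (1 / \<epsilon>) *\<^sub>R (E' s z' - snd (\<Phi> s z'))))
        \<le> C * norm (\<Phi> s z - \<Phi> s z') + 0"
        using n(2) by (simp add: C_def algebra_simps add_divide_distrib)
    qed
    then show ?thesis by (simp add: init)
  qed
  have "(sqrt (exp ((2 * C + 1) * t)))-lipschitz_on UNIV (\<Phi> t)"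
  proof (rule lipschitz_onI)
    fix z z'
    show "dist (\<Phi> t z) (\<Phi> t z') \<le> sqrt (exp ((2 * C + 1) * t)) * dist z z'"
      using real_sqrt_le_mono[OF bound[of z z']] by (simp add: dist_norm real_sqrt_mult mult.commute)
  qed simp
  then show ?thesis by (rule lipschitz_on_continuous_on)
qed

section \<open>Continuous functions with bounded weak derivatives\<close>

lemma DERIV_positive_part_squared:
  "((\<lambda>s::real. (max 0 s)\<^sup>2) has_real_derivative 2 * max 0 s) (at s)"
proof -
  consider "s > 0" | "s < 0" | "s = 0" by linarith
  then show ?thesis
  proof cases
    case 1
    have "((\<lambda>s::real. s\<^sup>2) has_real_derivative 2 * max 0 s) (at s)"
      using 1 by (auto intro!: derivative_eq_intros)
    then show ?thesis
      by (rule has_field_derivative_transform_within_open[where S = "{0<..}"]) (use 1 in auto)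
  next
    case 2
    have "((\<lambda>s::real. 0) has_real_derivative 2 * max 0 s) (at s)"
      using 2 by (auto intro!: derivative_eq_intros)
    then show ?thesis
      by (rule has_field_derivative_transform_within_open[where S = "{..<0}"]) (use 2 in auto)
  next
    case 3
    have "((\<lambda>h::real. (max 0 h)\<^sup>2 / h) \<longlongrightarrow> 0) (at 0)"
      by (rule Lim_null_comparison[where g = abs])
        (auto intro!: always_eventually tendsto_eq_intros simp: max_def power2_eq_square)
    then show ?thesis using 3 by (simp add: has_field_derivative_iff)
  qed
qed

text \<open>The weight \<open>(r\<^sup>2 - \<bar>y - z\<bar>\<^sup>2)\<^sub>+\<^sup>2\<close> is among the simplest functions of class \<open>C\<^sup>1\<close> supported in the ball
of radius \<open>r\<close> around \<open>z\<close>. It is left unnormalised; averages are divided by its mass.\<close>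

definition bump :: "'a::euclidean_space \<Rightarrow> real \<Rightarrow> 'a \<Rightarrow> real" where
  "bump z r y = (max 0 (r\<^sup>2 - (y - z) \<bullet> (y - z)))\<^sup>2"

definition bump_gradient :: "'a::euclidean_space \<Rightarrow> real \<Rightarrow> 'a \<Rightarrow> 'a" where
  "bump_gradient z r y = - (4 * max 0 (r\<^sup>2 - (y - z) \<bullet> (y - z))) *\<^sub>R (y - z)"

lemma bump_nonneg: "bump z r y \<ge> 0"
  by (simp add: bump_def)

lemma bump_outside:
  assumes "r > 0" "y \<notin> cball z r"
  shows "bump z r y = 0" "bump_gradient z r y = 0"
proof -
  have "r \<le> norm (y - z)" using assms by (simp add: dist_norm norm_minus_commute)
  then have "r\<^sup>2 \<le> (norm (y - z))\<^sup>2" using assms(1) by (intro power_mono) auto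
  then show "bump z r y = 0" "bump_gradient z r y = 0"
    by (auto simp: bump_def bump_gradient_def power2_norm_eq_inner)
qed

lemma continuous_on_bump [continuous_intros]:
  assumes "continuous_on S f" "continuous_on S g"
  shows "continuous_on S (\<lambda>x. bump (f x) r (g x))" "continuous_on S (\<lambda>x. bump_gradient (f x) r (g x))"
  unfolding bump_def bump_gradient_def by (intro continuous_intros assms)+

lemma bump_test_function:
  assumes "r > 0"
  shows "test_function (bump z r) (bump_gradient z r)"
  unfolding test_function_def
proof (intro conjI allI)
  show "GDERIV (bump z r) y :> bump_gradient z r y" for y
  proof -
    have "((\<lambda>y. r\<^sup>2 - (y - z) \<bullet> (y - z)) has_derivative (\<lambda>h. - (2 * ((y - z) \<bullet> h)))) (at y)"
      by (auto intro!: derivative_eq_intros simp: inner_commute)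
    from DERIV_compose_FDERIV[OF DERIV_positive_part_squared this]
    show ?thesis
      unfolding gderiv_def bump_def[abs_def] bump_gradient_def
      by (simp add: algebra_simps inner_commute)
  qed
  show "continuous_on UNIV (bump_gradient z r)" by (intro continuous_intros)
  have "{y. bump z r y \<noteq> 0} \<subseteq> cball z r" using bump_outside[OF assms] by blast
  then show "compact (closure {y. bump z r y \<noteq> 0})"
    using bounded_subset[OF bounded_cball] compact_closure by blast
qed

lemma continuous_compact_support_integral:
  fixes f :: "'a::euclidean_space \<Rightarrow> 'b::euclidean_space"
  assumes "continuous_on UNIV f" "\<And>y. y \<notin> cbox a c \<Longrightarrow> f y = 0"
  shows "integrable lebesgue f" "integral\<^sup>L lebesgue f = integral (cbox a c) f"
proof -
  have f: "f = (\<lambda>y. indicat_real (cbox a c) y *\<^sub>R f y)"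
    using assms(2) by (auto simp: indicator_def)
  have *: "set_integrable lebesgue (cbox a c) f"
    by (intro absolutely_integrable_continuous continuous_on_subset[OF assms(1)]) auto
  then show "integrable lebesgue f" using f by (simp add: set_integrable_def)
  show "integral\<^sup>L lebesgue f = integral (cbox a c) f"
    using set_lebesgue_integral_eq_integral(2)[OF *] f by (simp add: set_lebesgue_integral_def)
qed

lemma integrable_bump_times:
  fixes g :: "'a::euclidean_space \<Rightarrow> 'b::euclidean_space"
  assumes "r > 0" "continuous_on UNIV g"
  shows "integrable lebesgue (\<lambda>y. bump z r y *\<^sub>R g y)"
proof -
  obtain a where a: "cball z r \<subseteq> cbox (- a) a"
    using bounded_subset_cbox_symmetric[OF bounded_cball] by blast
  then have "bump z r y *\<^sub>R g y = 0" if "y \<notin> cbox (- a) a" for y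
  proof -
    have "y \<notin> cball z r" using a that by blast
    from bump_outside(1)[OF assms(1) this] show ?thesis by simp
  qed
  then show ?thesis
    by (intro continuous_compact_support_integral(1)[of _ "- a" a] continuous_intros assms(2))
qed

text \<open>By translation invariance the mass depends on \<open>r\<close> alone and not on the centre; the type argument
fixes the dimension.\<close>

definition bump_mass :: "'a::euclidean_space itself \<Rightarrow> real \<Rightarrow> real" where
  "bump_mass _ r = (\<integral>y. bump (0::'a) r y \<partial>lebesgue)"

lemma integral_bump: "(\<integral>y. bump (z::'a::euclidean_space) r y \<partial>lebesgue) = bump_mass TYPE('a) r"
proof -
  have m: "bump z r \<in> borel_measurable borel" for z :: 'a
    by (intro borel_measurable_continuous_onI continuous_intros)
  have "(\<integral>y. bump z r y \<partial>lebesgue) = (\<integral>y. bump z r y \<partial>distr lborel borel ((+) z))"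
    using m by (simp add: integral_completion lborel_distr_plus)
  also have "\<dots> = (\<integral>y. bump z r (z + y) \<partial>lborel)"
    using m by (intro integral_distr) auto
  also have "\<dots> = bump_mass TYPE('a) r"
    using m by (simp add: bump_mass_def integral_completion bump_def)
  finally show ?thesis .
qed

text \<open>A continuous nonnegative function of vanishing integral is zero almost everywhere, hence
everywhere; but the bump does not vanish at its centre.\<close>

lemma bump_mass_pos:
  assumes "r > 0"
  shows "bump_mass TYPE('a::euclidean_space) r > 0"
proof -
  have int: "integrable lebesgue (bump (0::'a) r)"
    using integrable_bump_times[OF assms, of "\<lambda>_. 1::real" "0::'a"] by simp
  have nonneg: "bump_mass TYPE('a) r \<ge> 0"
    unfolding bump_mass_def by (intro integral_nonneg_AE) (auto simp: bump_nonneg)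
  moreover have "bump_mass TYPE('a) r \<noteq> 0"
  proof
    assume "bump_mass TYPE('a) r = 0"
    then have "AE y in lebesgue. y \<in> {y::'a. bump 0 r y = 0}"
      using integral_nonneg_eq_0_iff_AE[OF int] by (simp add: bump_mass_def bump_nonneg)
    moreover have "closed {y::'a. bump 0 r y = 0}"
      by (intro closed_Collect_eq continuous_intros)
    ultimately have "bump 0 r (0::'a) = 0"
      using mem_closed_if_AE_lebesgue by blast
    then show False using assms by (simp add: bump_def)
  qed
  ultimately show ?thesis by simp
qed

lemma bump_average_tendsto:
  fixes g :: "'a::euclidean_space \<Rightarrow> 'b::euclidean_space"
  assumes g: "continuous_on UNIV g"
  shows "((\<lambda>r. (\<integral>y. bump z r y *\<^sub>R g y \<partial>lebesgue) /\<^sub>R bump_mass TYPE('a) r) \<longlongrightarrow> g z) (at_right 0)"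
proof (rule tendstoI)
  fix e :: real assume e: "e > 0"
  obtain d where d: "d > 0" "\<And>y. dist y z < d \<Longrightarrow> dist (g y) (g z) < e / 2"
    using g[unfolded continuous_on_iff, rule_format, of z "e / 2"] e by auto
  have "\<forall>\<^sub>F r in at_right 0. r \<in> {0<..<d}"
    using eventually_at_right_real[OF d(1)] .
  then show "\<forall>\<^sub>F r in at_right 0.
      dist ((\<integral>y. bump z r y *\<^sub>R g y \<partial>lebesgue) /\<^sub>R bump_mass TYPE('a) r) (g z) < e"
  proof eventually_elim
    case (elim r)
    then have r: "r > 0" "r < d" by auto
    let ?m = "bump_mass TYPE('a) r"
    have m: "?m > 0" using bump_mass_pos[OF r(1)] .
    have b: "integrable lebesgue (bump z r)"
      using integrable_bump_times[OF r(1), of "\<lambda>_. 1::real"] by simp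
    have bg: "integrable lebesgue (\<lambda>y. bump z r y *\<^sub>R g y)"
      by (rule integrable_bump_times[OF r(1) g])
    have "(\<integral>y. bump z r y *\<^sub>R g y \<partial>lebesgue) - ?m *\<^sub>R g z
        = (\<integral>y. bump z r y *\<^sub>R g y - bump z r y *\<^sub>R g z \<partial>lebesgue)"
      using b bg by (simp add: integral_bump)
    also have "norm \<dots> \<le> (\<integral>y. norm (bump z r y *\<^sub>R g y - bump z r y *\<^sub>R g z) \<partial>lebesgue)"
      by (rule integral_norm_bound)
    also have "\<dots> \<le> (\<integral>y. bump z r y * (e / 2) \<partial>lebesgue)"
    proof (rule integral_mono)
      show "integrable lebesgue (\<lambda>y. norm (bump z r y *\<^sub>R g y - bump z r y *\<^sub>R g z))"
        using b bg by auto
      show "integrable lebesgue (\<lambda>y. bump z r y * (e / 2))" using b by auto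
      show "norm (bump z r y *\<^sub>R g y - bump z r y *\<^sub>R g z) \<le> bump z r y * (e / 2)" for y
      proof (cases "y \<in> cball z r")
        case True
        then have "dist (g y) (g z) < e / 2" using d(2) r(2) by (simp add: dist_commute)
        then have "bump z r y * norm (g y - g z) \<le> bump z r y * (e / 2)"
          using bump_nonneg[of z r y] by (intro mult_left_mono) (auto simp: dist_norm)
        then show ?thesis
          using bump_nonneg[of z r y] by (simp add: scaleR_diff_right[symmetric])
      next
        case False
        then show ?thesis using bump_outside(1)[OF r(1) False] by simp
      qed
    qed
    also have "\<dots> = ?m * (e / 2)" using b by (simp add: integral_bump)
    finally have *: "norm ((\<integral>y. bump z r y *\<^sub>R g y \<partial>lebesgue) - ?m *\<^sub>R g z) \<le> ?m * (e / 2)" .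
    have "(\<integral>y. bump z r y *\<^sub>R g y \<partial>lebesgue) /\<^sub>R ?m - g z
        = ((\<integral>y. bump z r y *\<^sub>R g y \<partial>lebesgue) - ?m *\<^sub>R g z) /\<^sub>R ?m"
      using m by (simp add: scaleR_diff_right)
    then have "dist ((\<integral>y. bump z r y *\<^sub>R g y \<partial>lebesgue) /\<^sub>R ?m) (g z)
        = norm ((\<integral>y. bump z r y *\<^sub>R g y \<partial>lebesgue) - ?m *\<^sub>R g z) / ?m"
      using m by (simp add: dist_norm divide_inverse_commute)
    also have "\<dots> \<le> e / 2" using * m by (simp add: divide_le_eq mult.commute)
    finally show ?case using e by simp
  qed
qed

text \<open>The bump depends only on \<open>y - z\<close>, so moving its centre along \<open>b\<close> produces minus the partial derivative
in \<open>y\<close>: this is how a weak derivative in \<open>y\<close> controls a classical one along the line of centres.\<close>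

lemma bump_shift_derivative:
  "((\<lambda>s. bump (x + s *\<^sub>R b) r y) has_real_derivative - (bump_gradient (x + s *\<^sub>R b) r y \<bullet> b)) (at s within S)"
proof -
  have "((\<lambda>s. r\<^sup>2 - (y - (x + s *\<^sub>R b)) \<bullet> (y - (x + s *\<^sub>R b))) has_derivative
      (\<lambda>h. h * (2 * ((y - (x + s *\<^sub>R b)) \<bullet> b)))) (at s within S)"
    by (auto intro!: derivative_eq_intros simp: inner_commute algebra_simps)
  then have "((\<lambda>s. r\<^sup>2 - (y - (x + s *\<^sub>R b)) \<bullet> (y - (x + s *\<^sub>R b))) has_real_derivative
      2 * ((y - (x + s *\<^sub>R b)) \<bullet> b)) (at s within S)"
    by (simp add: has_field_derivative_def mult.commute[of _ "2 * _"] mult_commute_abs)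
  from DERIV_chain2[OF DERIV_positive_part_squared this]
  show ?thesis by (simp add: bump_def bump_gradient_def mult.assoc)
qed

text \<open>As a function of the position \<open>s\<close> of the centre on the segment, the local integral is
differentiable: differentiation under the integral sign gives \<open>- \<integral> (\<partial>\<^sub>b bump) g\<close>, which the definition of
the weak derivative turns into \<open>\<integral> bump w\<close>. The latter is at most \<open>C\<close> times the mass, for every \<open>s\<close>.\<close>

lemma bump_average_increment:
  fixes g w :: "'a::euclidean_space \<Rightarrow> 'b::euclidean_space"
  assumes g: "continuous_on UNIV g" and w: "weak_partial b g w" "w \<in> borel_measurable lebesgue"
    and C: "AE y in lebesgue. norm (w y) \<le> C" and r: "r > 0" and h: "h \<ge> 0"
  shows "norm ((\<integral>y. bump (x + h *\<^sub>R b) r y *\<^sub>R g y \<partial>lebesgue) - (\<integral>y. bump x r y *\<^sub>R g y \<partial>lebesgue))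
    \<le> C * h * bump_mass TYPE('a) r"
proof -
  define z where "z s = x + s *\<^sub>R b" for s
  let ?I = "\<lambda>s. \<integral>y. bump (z s) r y *\<^sub>R g y \<partial>lebesgue"
  let ?m = "bump_mass TYPE('a) r"
  have z_cont: "continuous_on S z" for S unfolding z_def by (intro continuous_intros)
  \<comment> \<open>one box for the supports of all shifted bumps, so that the Leibniz rule on a box applies\<close>
  have "bounded (\<Union>s\<in>{0..h}. cball (z s) r)"
  proof -
    have "bounded (z ` {0..h})"
      by (intro compact_imp_bounded compact_continuous_image z_cont) auto
    then obtain R where R: "\<And>s. s \<in> {0..h} \<Longrightarrow> norm (z s) \<le> R" unfolding bounded_iff by blast
    have "norm y \<le> R + r" if "s \<in> {0..h}" "y \<in> cball (z s) r" for s y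
      using R[OF that(1)] that(2) norm_triangle_sub[of y "z s"]
      by (simp add: dist_norm norm_minus_commute)
    then show ?thesis unfolding bounded_iff by blast
  qed
  then obtain a where a: "(\<Union>s\<in>{0..h}. cball (z s) r) \<subseteq> cbox (- a) a"
    using bounded_subset_cbox_symmetric by blast
  have out: "bump (z s) r y = 0" "bump_gradient (z s) r y = 0" if "s \<in> {0..h}" "y \<notin> cbox (- a) a" for s y
  proof -
    have "y \<notin> cball (z s) r" using a that by blast
    from bump_outside[OF r this] show "bump (z s) r y = 0" "bump_gradient (z s) r y = 0" .
  qed
  have box: "?I s = integral (cbox (- a) a) (\<lambda>y. bump (z s) r y *\<^sub>R g y)" if "s \<in> {0..h}" for s
    using out that by (intro continuous_compact_support_integral(2) continuous_intros g) auto
  have der: "((\<lambda>s. integral (cbox (- a) a) (\<lambda>y. bump (z s) r y *\<^sub>R g y)) has_vector_derivative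
      (\<integral>y. bump (z s) r y *\<^sub>R w y \<partial>lebesgue)) (at s within {0..h})" if s: "s \<in> {0..h}" for s
  proof -
    have g': "continuous_on S (\<lambda>p. g (f p))" if "continuous_on S f" for S and f :: "real \<times> 'a \<Rightarrow> 'a"
      using continuous_on_compose2[OF g that] by auto
    have "((\<lambda>s. integral (cbox (- a) a) (\<lambda>y. bump (z s) r y *\<^sub>R g y)) has_vector_derivative
      integral (cbox (- a) a) (\<lambda>y. - (bump_gradient (z s) r y \<bullet> b) *\<^sub>R g y)) (at s within {0..h})"
    proof (rule leibniz_rule_vector_derivative[OF _ _ _ s])
      show "((\<lambda>s. bump (z s) r y *\<^sub>R g y) has_vector_derivative
          - (bump_gradient (z s) r y \<bullet> b) *\<^sub>R g y) (at s within {0..h})" for s y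
        using has_vector_derivative_scaleR[OF bump_shift_derivative has_vector_derivative_const[of "g y"]]
        unfolding z_def by simp
      show "(\<lambda>y. bump (z s) r y *\<^sub>R g y) integrable_on cbox (- a) a" for s
        by (intro integrable_continuous continuous_intros continuous_on_subset[OF g]) auto
      show "continuous_on ({0..h} \<times> cbox (- a) a)
          (\<lambda>(s, y). - (bump_gradient (z s) r y \<bullet> b) *\<^sub>R g y)"
        unfolding case_prod_beta z_def by (intro continuous_intros g')
    qed auto
    also have "integral (cbox (- a) a) (\<lambda>y. - (bump_gradient (z s) r y \<bullet> b) *\<^sub>R g y)
        = - (\<integral>y. (bump_gradient (z s) r y \<bullet> b) *\<^sub>R g y \<partial>lebesgue)"
    proof -
      have "(\<integral>y. - (bump_gradient (z s) r y \<bullet> b) *\<^sub>R g y \<partial>lebesgue)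
          = integral (cbox (- a) a) (\<lambda>y. - (bump_gradient (z s) r y \<bullet> b) *\<^sub>R g y)"
        using out[OF s] by (intro continuous_compact_support_integral(2) continuous_intros g) auto
      then show ?thesis by simp
    qed
    also have "\<dots> = (\<integral>y. bump (z s) r y *\<^sub>R w y \<partial>lebesgue)"
      using w(1) bump_test_function[OF r, of "z s"] unfolding weak_partial_def by simp
    finally show ?thesis .
  qed
  have bound: "norm (\<integral>y. bump (z s) r y *\<^sub>R w y \<partial>lebesgue) \<le> C * ?m" for s
  proof -
    have b: "integrable lebesgue (bump (z s) r)"
      using integrable_bump_times[OF r, of "\<lambda>_. 1::real"] by simp
    have le: "AE y in lebesgue. norm (bump (z s) r y *\<^sub>R w y) \<le> C * bump (z s) r y"
      using C
    proof eventually_elim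
      case (elim y)
      from mult_left_mono[OF elim bump_nonneg[of "z s" r y]] show ?case
        by (simp add: bump_nonneg mult.commute)
    qed
    have bw: "integrable lebesgue (\<lambda>y. bump (z s) r y *\<^sub>R w y)"
    proof (rule Bochner_Integration.integrable_bound)
      show "integrable lebesgue (\<lambda>y. C * bump (z s) r y)" using b by simp
      show "(\<lambda>y. bump (z s) r y *\<^sub>R w y) \<in> borel_measurable lebesgue"
        using w(2) borel_measurable_integrable[OF b] by measurable
      show "AE y in lebesgue. norm (bump (z s) r y *\<^sub>R w y) \<le> norm (C * bump (z s) r y)"
        using le by eventually_elim auto
    qed
    have "norm (\<integral>y. bump (z s) r y *\<^sub>R w y \<partial>lebesgue) \<le> (\<integral>y. norm (bump (z s) r y *\<^sub>R w y) \<partial>lebesgue)"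
      by (rule integral_norm_bound)
    also have "\<dots> \<le> (\<integral>y. C * bump (z s) r y \<partial>lebesgue)"
      by (rule integral_mono_AE[OF integrable_norm[OF bw] _ le]) (use b in simp)
    also have "\<dots> = C * ?m" by (simp add: integral_bump)
    finally show ?thesis .
  qed
  have "norm (integral (cbox (- a) a) (\<lambda>y. bump (z h) r y *\<^sub>R g y)
      - integral (cbox (- a) a) (\<lambda>y. bump (z 0) r y *\<^sub>R g y)) \<le> C * ?m * h - C * ?m * 0"
    by (rule norm_increment_le_of_derivative_le[OF h order_refl der])
      (auto intro!: derivative_eq_intros bound)
  then show ?thesis using box[of h] box[of 0] h by (simp add: z_def mult.assoc mult.commute[of h])
qed

text \<open>The bound for local averages is independent of the radius, and the averages of a continuous
function converge to its values as the radius shrinks.\<close>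

lemma bounded_weak_partial_imp_lipschitz_direction:
  fixes g w :: "'a::euclidean_space \<Rightarrow> 'b::euclidean_space"
  assumes g: "continuous_on UNIV g" and w: "weak_partial b g w" "w \<in> borel_measurable lebesgue"
    and C: "AE y in lebesgue. norm (w y) \<le> C"
  shows "norm (g (x + h *\<^sub>R b) - g x) \<le> C * \<bar>h\<bar>"
proof -
  have nonneg: "norm (g (x + h *\<^sub>R b) - g x) \<le> C * h" if h: "h \<ge> 0" for x h
  proof (rule tendsto_upperbound)
    let ?A = "\<lambda>z r. (\<integral>y. bump z r y *\<^sub>R g y \<partial>lebesgue) /\<^sub>R bump_mass TYPE('a) r"
    show "((\<lambda>r. norm (?A (x + h *\<^sub>R b) r - ?A x r)) \<longlongrightarrow> norm (g (x + h *\<^sub>R b) - g x)) (at_right 0)"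
      by (intro tendsto_intros bump_average_tendsto g)
    show "\<forall>\<^sub>F r in at_right 0. norm (?A (x + h *\<^sub>R b) r - ?A x r) \<le> C * h"
      using eventually_at_right_less[of "0::real"]
    proof eventually_elim
      case (elim r)
      have m: "bump_mass TYPE('a) r > 0" by (rule bump_mass_pos[OF elim])
      have "norm (?A (x + h *\<^sub>R b) r - ?A x r)
          = norm ((\<integral>y. bump (x + h *\<^sub>R b) r y *\<^sub>R g y \<partial>lebesgue) - (\<integral>y. bump x r y *\<^sub>R g y \<partial>lebesgue))
            / bump_mass TYPE('a) r"
        using m by (simp add: scaleR_diff_right[symmetric] divide_inverse_commute)
      also have "\<dots> \<le> C * h"
        using bump_average_increment[OF g w C elim h, of x] m by (simp add: divide_le_eq)
      finally show ?case .
    qed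
  qed simp
  show ?thesis
    using nonneg[of h x] nonneg[of "- h" "x + h *\<^sub>R b"]
    by (cases "h \<ge> 0") (auto simp: norm_minus_commute)
qed

lemma continuous_L_infty_imp_bounded:
  fixes g :: "'a::euclidean_space \<Rightarrow> 'b::euclidean_space"
  assumes g: "continuous_on UNIV g" and L: "g \<in> L_infty"
  shows "\<exists>M. \<forall>x. norm (g x) \<le> M"
proof -
  obtain M where M: "AE x in lebesgue. norm (g x) \<le> M"
    using L by (auto simp: L_infty_def)
  have "closed {x. norm (g x) \<le> M}" by (intro closed_Collect_le continuous_intros g)
  then have "norm (g x) \<le> M" for x
    using mem_closed_if_AE_lebesgue[of "{x. norm (g x) \<le> M}" x] M by simp
  then show ?thesis by blast
qed

text \<open>From one point one reaches any other along the coordinate directions, one after the other, and each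
leg is at most as long as the whole displacement.\<close>

lemma continuous_W_1_infty_imp_lipschitz:
  fixes g :: "'a::euclidean_space \<Rightarrow> 'b::euclidean_space"
  assumes g: "continuous_on UNIV g" and W: "g \<in> W_1_infty"
  shows "\<exists>L>0. \<forall>x y. norm (g x - g y) \<le> L * norm (x - y)"
proof -
  have "\<exists>C. \<forall>x h. norm (g (x + h *\<^sub>R b) - g x) \<le> C * \<bar>h\<bar>" if "b \<in> Basis" for b
    using W that bounded_weak_partial_imp_lipschitz_direction[OF g]
    unfolding W_1_infty_def L_infty_def by blast
  then obtain C where C: "\<And>b x h. b \<in> Basis \<Longrightarrow> norm (g (x + h *\<^sub>R b) - g x) \<le> C b * \<bar>h\<bar>"
    by metis
  have partial: "norm (g (x + (\<Sum>b\<in>B. (h \<bullet> b) *\<^sub>R b)) - g x) \<le> (\<Sum>b\<in>B. \<bar>C b\<bar> * norm h)"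
    if "finite B" "B \<subseteq> Basis" for B x h
    using that
  proof (induction B arbitrary: x)
    case (insert b B)
    let ?y = "x + (h \<bullet> b) *\<^sub>R b"
    have "norm (g ?y - g x) \<le> C b * \<bar>h \<bullet> b\<bar>" using C insert.prems by auto
    also have "\<dots> \<le> \<bar>C b\<bar> * norm h"
      using insert.prems Basis_le_norm[of b h] by (intro mult_mono) auto
    finally have 1: "norm (g ?y - g x) \<le> \<bar>C b\<bar> * norm h" .
    have 2: "norm (g (?y + (\<Sum>b\<in>B. (h \<bullet> b) *\<^sub>R b)) - g ?y) \<le> (\<Sum>b\<in>B. \<bar>C b\<bar> * norm h)"
      using insert by auto
    show ?case
      using norm_triangle_ineq[of "g (?y + (\<Sum>b\<in>B. (h \<bullet> b) *\<^sub>R b)) - g ?y" "g ?y - g x"] 1 2 insert.hyps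
      by (simp add: add.assoc)
  qed simp
  \<comment> \<open>the summand 1 makes the constant positive even when all \<open>C b\<close> vanish\<close>
  let ?L = "(\<Sum>b\<in>Basis. \<bar>C b\<bar>) + 1"
  have "norm (g x - g y) \<le> ?L * norm (x - y)" for x y
  proof -
    have "norm (g x - g y) \<le> (\<Sum>b\<in>Basis. \<bar>C b\<bar> * norm (x - y))"
      using partial[of Basis y "x - y"] by (simp add: euclidean_representation)
    also have "\<dots> \<le> (\<Sum>b\<in>Basis. \<bar>C b\<bar> * norm (x - y)) + norm (x - y)" by simp
    finally show ?thesis by (simp add: sum_distrib_right distrib_right)
  qed
  moreover have "?L > 0" by (intro add_nonneg_pos sum_nonneg) auto
  ultimately show ?thesis by blast
qed

section \<open>Mean fields of a Lipschitz kernel\<close>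

lemma P1D:
  assumes "\<mu> \<in> P1"
  shows "prob_space \<mu>" "sets \<mu> = sets borel" "integrable \<mu> norm"
  using assms by (auto simp: P1_def)

lemma marginal1_P1:
  assumes "\<mu> \<in> P1"
  shows "prob_space (marginal1 \<mu>)" "sets (marginal1 \<mu>) = sets borel"
proof -
  have "fst \<in> borel_measurable \<mu>"
    using P1D(2)[OF assms] by (simp add: borel_prod[symmetric] cong: measurable_cong_sets)
  then show "prob_space (marginal1 \<mu>)"
    unfolding marginal1_def by (rule prob_space.prob_space_distr[OF P1D(1)[OF assms]])
qed (simp add: marginal1_def)

text \<open>What the mean-field estimates use of \<open>\<nabla>K\<close>. Strict positivity of \<open>L\<close> permits dividing by it, which
avoids the product \<open>0 \<cdot> \<infinity>\<close> when the Wasserstein distance is infinite.\<close>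

locale bounded_lipschitz_kernel =
  fixes G :: "'a::euclidean_space \<Rightarrow> 'a" and M L :: real
  assumes bounded: "norm (G x) \<le> M"
    and lipschitz: "norm (G x - G y) \<le> L * norm (x - y)"
    and L_pos: "L > 0"
begin

lemma measurable [measurable]: "G \<in> borel_measurable borel"
proof -
  have "L-lipschitz_on UNIV G"
    using lipschitz L_pos by (intro lipschitz_onI) (auto simp: dist_norm)
  then show ?thesis
    by (intro borel_measurable_continuous_onI lipschitz_on_continuous_on)
qed

lemma integrable_comp:
  assumes "prob_space N" and [measurable]: "X \<in> borel_measurable N"
  shows "integrable N (\<lambda>z. G (x - X z))"
proof -
  interpret prob_space N by fact
  show ?thesis by (rule integrable_const_bound[where B = M]) (auto simp: bounded)
qed

text \<open>Two random variables on a common probability space couple their laws. The variables of interest are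
the positions of the same particle at two times.\<close>

lemma conv_measure_diff_le:
  assumes N: "prob_space N" and X[measurable]: "X \<in> borel_measurable N" and Y[measurable]: "Y \<in> borel_measurable N"
    and c: "integrable N c" and le: "\<And>z. z \<in> space N \<Longrightarrow> norm (X z - Y z) \<le> c z"
  shows "norm (conv_measure G (distr N borel X) x - conv_measure G (distr N borel Y) x)
    \<le> L * (\<integral>z. c z \<partial>N)"
proof -
  have "conv_measure G (distr N borel X) x - conv_measure G (distr N borel Y) x
      = (\<integral>z. G (x - X z) - G (x - Y z) \<partial>N)"
    using integrable_comp[OF N X] integrable_comp[OF N Y]
    by (simp add: conv_measure_def integral_distr)
  also have "norm \<dots> \<le> (\<integral>z. norm (G (x - X z) - G (x - Y z)) \<partial>N)"
    by (rule integral_norm_bound)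
  also have "\<dots> \<le> (\<integral>z. L * c z \<partial>N)"
  proof (rule integral_mono)
    show "integrable N (\<lambda>z. norm (G (x - X z) - G (x - Y z)))"
      using integrable_comp[OF N X] integrable_comp[OF N Y] by auto
    show "integrable N (\<lambda>z. L * c z)" using c by simp
    show "norm (G (x - X z) - G (x - Y z)) \<le> L * c z" if "z \<in> space N" for z
    proof -
      have "norm (G (x - X z) - G (x - Y z)) \<le> L * norm (X z - Y z)"
        using lipschitz[of "x - X z" "x - Y z"] by (simp add: norm_minus_commute)
      also have "\<dots> \<le> L * c z" using le[OF that] L_pos by simp
      finally show ?thesis .
    qed
  qed
  finally show ?thesis by simp
qed

lemma conv_measure_bounded:
  assumes "prob_space \<mu>" "sets \<mu> = sets borel"
  shows "norm (conv_measure G \<mu> x) \<le> M"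
proof -
  interpret prob_space \<mu> by fact
  have int: "integrable \<mu> (\<lambda>y. G (x - y))"
    using integrable_comp[OF assms(1), of "\<lambda>y. y"] assms(2) by (simp cong: measurable_cong_sets)
  have "norm (conv_measure G \<mu> x) \<le> (\<integral>y. norm (G (x - y)) \<partial>\<mu>)"
    unfolding conv_measure_def by (rule integral_norm_bound)
  also have "\<dots> \<le> (\<integral>y. M \<partial>\<mu>)"
    using int by (intro integral_mono) (auto simp: bounded)
  finally show ?thesis by (simp add: prob_space)
qed

lemma conv_measure_lipschitz:
  assumes "prob_space \<mu>" "sets \<mu> = sets borel"
  shows "norm (conv_measure G \<mu> x - conv_measure G \<mu> y) \<le> L * norm (x - y)"
proof -
  interpret prob_space \<mu> by fact
  have int: "integrable \<mu> (\<lambda>y. G (x - y))" for x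
    using integrable_comp[OF assms(1), of "\<lambda>y. y"] assms(2) by (simp cong: measurable_cong_sets)
  have "norm (conv_measure G \<mu> x - conv_measure G \<mu> y) = norm (\<integral>z. G (x - z) - G (y - z) \<partial>\<mu>)"
    using int by (simp add: conv_measure_def)
  also have "\<dots> \<le> (\<integral>z. norm (G (x - z) - G (y - z)) \<partial>\<mu>)"
    by (rule integral_norm_bound)
  also have "\<dots> \<le> (\<integral>z. L * norm (x - y) \<partial>\<mu>)"
  proof (rule integral_mono)
    show "norm (G (x - z) - G (y - z)) \<le> L * norm (x - y)" for z
      using lipschitz[of "x - z" "y - z"] by simp
  qed (use int in auto)
  finally show ?thesis by (simp add: prob_space)
qed

text \<open>The easy half of Kantorovich duality: under any coupling the two convolutions differ by an
expectation bounded by \<open>L\<close> times the transport cost.\<close>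

lemma conv_measure_diff_le_W1:
  assumes \<mu>: "prob_space \<mu>"
  shows "ennreal (norm (conv_measure G \<mu> x - conv_measure G \<nu> x) / L) \<le> W1 \<mu> \<nu>"
  unfolding W1_def
proof (rule INF_greatest)
  fix \<pi> assume "\<pi> \<in> couplings \<mu> \<nu>"
  then have sets: "sets \<pi> = sets borel" and fst: "distr \<pi> borel fst = \<mu>" and snd: "distr \<pi> borel snd = \<nu>"
    by (auto simp: couplings_def)
  have [measurable]: "fst \<in> borel_measurable \<pi>" "snd \<in> borel_measurable \<pi>"
    using sets by (simp_all add: borel_prod[symmetric] cong: measurable_cong_sets)
  have \<pi>: "prob_space \<pi>" using \<mu> fst prob_space_distrD[of fst \<pi> borel] by simp
  have int: "integrable \<pi> (\<lambda>z. G (x - fst z))" "integrable \<pi> (\<lambda>z. G (x - snd z))"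
    by (auto intro!: integrable_comp \<pi>)
  have "conv_measure G \<mu> x - conv_measure G \<nu> x = (\<integral>z. G (x - fst z) - G (x - snd z) \<partial>\<pi>)"
    using int by (simp add: conv_measure_def integral_distr fst[symmetric] snd[symmetric])
  then have "norm (conv_measure G \<mu> x - conv_measure G \<nu> x) / L
      = norm (\<integral>z. (1 / L) *\<^sub>R (G (x - fst z) - G (x - snd z)) \<partial>\<pi>)"
    using L_pos by simp
  also have "ennreal \<dots> \<le> (\<integral>\<^sup>+z. norm ((1 / L) *\<^sub>R (G (x - fst z) - G (x - snd z))) \<partial>\<pi>)"
    using int by (intro integral_norm_bound_ennreal) auto
  also have "\<dots> \<le> (\<integral>\<^sup>+z. ennreal (dist (fst z) (snd z)) \<partial>\<pi>)"
  proof (intro nn_integral_mono ennreal_leI)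
    fix z
    show "norm ((1 / L) *\<^sub>R (G (x - fst z) - G (x - snd z))) \<le> dist (fst z) (snd z)"
      using lipschitz[of "x - fst z" "x - snd z"] L_pos
      by (simp add: dist_norm norm_minus_commute divide_le_eq mult.commute)
  qed
  finally show "ennreal (norm (conv_measure G \<mu> x - conv_measure G \<nu> x) / L)
      \<le> (\<integral>\<^sup>+z. ennreal (dist (fst z) (snd z)) \<partial>\<pi>)" .
qed

lemma conv_measure_tendsto:
  assumes W1: "((\<lambda>i. W1 (\<mu> i) \<nu>) \<longlongrightarrow> 0) I" and \<mu>: "eventually (\<lambda>i. prob_space (\<mu> i)) I"
  shows "((\<lambda>i. conv_measure G (\<mu> i) x) \<longlongrightarrow> conv_measure G \<nu> x) I"
proof -
  let ?d = "\<lambda>i. norm (conv_measure G (\<mu> i) x - conv_measure G \<nu> x)"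
  have "((\<lambda>i. ennreal (?d i / L)) \<longlongrightarrow> ennreal 0) I"
    by (rule tendsto_sandwich[OF _ _ tendsto_const])
      (use W1 in \<open>auto intro: eventually_mono[OF \<mu>] conv_measure_diff_le_W1\<close>)
  then have "((\<lambda>i. ?d i / L) \<longlongrightarrow> 0) I"
    by (rule tendsto_ennrealD) (use L_pos in auto)
  then have "((\<lambda>i. L * (?d i / L)) \<longlongrightarrow> L * 0) I" by (intro tendsto_intros)
  then have "(?d \<longlongrightarrow> 0) I" using L_pos by simp
  then show ?thesis by (simp add: tendsto_norm_zero_iff LIM_zero_iff)
qed

text \<open>Between times \<open>s\<close> and \<open>t\<close> every particle moves by at most its maximal speed times \<open>\<bar>t - s\<bar>\<close>, and averaged
over \<open>f0\<close> that speed is finite because \<open>f0\<close> has a first moment. The resulting constant is independent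
of \<open>\<epsilon>\<close>.\<close>

lemma kinetic_field_time_lipschitz:
  assumes sol: "kinetic_solution G \<epsilon> T f0 f" and \<epsilon>: "\<epsilon> > 0" and f0: "f0 \<in> P1"
    and s: "s \<in> {0..T}" and t: "t \<in> {0..T}"
  shows "norm (conv_measure G (marginal1 (f t)) y - conv_measure G (marginal1 (f s)) y)
    \<le> L * ((\<integral>z. norm (snd z) \<partial>f0) + M) * \<bar>t - s\<bar>"
proof -
  define E where "E = (\<lambda>t x. - conv_measure G (marginal1 (f t)) x)"
  obtain \<Phi> where flow: "kinetic_flow \<epsilon> T E \<Phi>" and f: "\<And>t. t \<in> {0..T} \<Longrightarrow> f t = distr f0 borel (\<Phi> t)"
    using sol unfolding kinetic_solution_def E_def Let_def by blast
  have P1: "f t \<in> P1" if "t \<in> {0..T}" for t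
    using sol that by (auto simp: kinetic_solution_def)
  note f0' = P1D[OF f0]
  interpret f0: prob_space f0 by (fact f0')
  have E_bound: "norm (E t y) \<le> M" if "t \<in> {0..T}" for t y
    using conv_measure_bounded[OF marginal1_P1[OF P1[OF that]]] by (simp add: E_def)
  have E_lip: "norm (E t y - E t z) \<le> L * norm (y - z)" if "t \<in> {0..T}" for t y z
    using conv_measure_lipschitz[OF marginal1_P1[OF P1[OF that]], of z y]
    by (simp add: E_def norm_minus_commute)
  have \<Phi>[measurable]: "\<Phi> t \<in> borel_measurable f0" if "t \<in> {0..T}" for t
    using borel_measurable_continuous_onI[OF kinetic_flow_continuous[OF flow \<epsilon> E_lip _ that]] L_pos f0'(2)
    by (simp cong: measurable_cong_sets)
  have fst_meas: "(fst :: 'a \<times> 'a \<Rightarrow> 'a) \<in> borel_measurable borel"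
    by (simp add: borel_prod[symmetric])
  have X[measurable]: "(\<lambda>z. fst (\<Phi> t z)) \<in> borel_measurable f0" if "t \<in> {0..T}" for t
    using measurable_compose[OF \<Phi>[OF that] fst_meas] .
  have marg: "marginal1 (f t) = distr f0 borel (\<lambda>z. fst (\<Phi> t z))" if "t \<in> {0..T}" for t
    using distr_distr[OF fst_meas \<Phi>[OF that]] by (simp add: marginal1_def f[OF that] comp_def)
  have int: "integrable f0 (\<lambda>z. norm (snd z))"
  proof (rule Bochner_Integration.integrable_bound[OF f0'(3)])
    show "(\<lambda>z. norm (snd z)) \<in> borel_measurable f0"
      using f0'(2) by (simp add: borel_prod[symmetric] cong: measurable_cong_sets)
    show "AE z in f0. norm (norm (snd z)) \<le> norm (norm z)"
      by (auto simp: norm_snd_le split_paired_all)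
  qed
  have "norm (conv_measure G (marginal1 (f t)) y - conv_measure G (marginal1 (f s)) y)
      \<le> L * (\<integral>z. (norm (snd z) + M) * \<bar>t - s\<bar> \<partial>f0)"
    unfolding marg[OF s] marg[OF t]
  proof (rule conv_measure_diff_le[OF f0'(1) X[OF t] X[OF s]])
    show "integrable f0 (\<lambda>z. (norm (snd z) + M) * \<bar>t - s\<bar>)" using int by auto
    show "norm (fst (\<Phi> t z) - fst (\<Phi> s z)) \<le> (norm (snd z) + M) * \<bar>t - s\<bar>" for z
    proof -
      have "kinetic_path \<epsilon> T E z (\<lambda>t. fst (\<Phi> t z)) (\<lambda>t. snd (\<Phi> t z))"
        using flow unfolding kinetic_flow_def by blast
      from kinetic_path_lipschitz[OF this \<epsilon> E_bound s t] show ?thesis .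
    qed
  qed
  also have "(\<integral>z. (norm (snd z) + M) * \<bar>t - s\<bar> \<partial>f0) = ((\<integral>z. norm (snd z) \<partial>f0) + M) * \<bar>t - s\<bar>"
    using int by (simp add: f0.prob_space)
  finally show ?thesis by (simp add: mult.assoc)
qed

end

section \<open>The small-inertia limit\<close>

text \<open>The limit for a single particle in given fields \<open>E \<epsilon>\<close> which converge pointwise and obey bounds that are
uniform in \<open>\<epsilon>\<close>. The equations \<open>X' = V\<close> and \<open>\<epsilon> V' = E - V\<close> add up to \<open>(X + \<epsilon> V)' = E\<close>, from which the stiff
term has disappeared. Since \<open>V\<close> is bounded uniformly in \<open>\<epsilon>\<close>, \<open>X + \<epsilon> V\<close> is a small perturbation of \<open>X\<close>
that nearly solves the macroscopic equation, and Gronwall compares it with \<open>x\<close>. For \<open>t > 0\<close> the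
velocity has relaxed to the field at the current position, up to \<open>exp (- t / \<epsilon>)\<close> and an error of order
\<open>\<epsilon>\<close>; at \<open>t = 0\<close> it is still \<open>v0\<close>, hence the half-open interval.\<close>

lemma small_inertia_limit:
  fixes E :: "real \<Rightarrow> real \<Rightarrow> 'a::euclidean_space \<Rightarrow> 'a" and E0 :: "real \<Rightarrow> 'a \<Rightarrow> 'a"
  assumes path: "\<And>\<epsilon>. \<epsilon> > 0 \<Longrightarrow> kinetic_path \<epsilon> T (E \<epsilon>) (x0, v0) (X \<epsilon>) (V \<epsilon>)"
    and macro: "macro_path T E0 x0 x"
    and bounded: "\<And>\<epsilon> t y. \<epsilon> > 0 \<Longrightarrow> t \<in> {0..T} \<Longrightarrow> norm (E \<epsilon> t y) \<le> M"
    and lip: "\<And>\<epsilon> t y z. \<epsilon> > 0 \<Longrightarrow> t \<in> {0..T} \<Longrightarrow> norm (E \<epsilon> t y - E \<epsilon> t z) \<le> L * norm (y - z)"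
    and time: "\<And>\<epsilon> s t y. \<epsilon> > 0 \<Longrightarrow> s \<in> {0..T} \<Longrightarrow> t \<in> {0..T} \<Longrightarrow>
      norm (E \<epsilon> t y - E \<epsilon> s y) \<le> \<kappa> * \<bar>t - s\<bar>"
    and lim: "\<And>t y. t \<in> {0..T} \<Longrightarrow> ((\<lambda>\<epsilon>. E \<epsilon> t y) \<longlongrightarrow> E0 t y) (at_right 0)"
    and L: "L > 0" and \<kappa>: "\<kappa> \<ge> 0" and T: "T > 0"
  shows "t \<in> {0..T} \<Longrightarrow> ((\<lambda>\<epsilon>. X \<epsilon> t) \<longlongrightarrow> x t) (at_right 0)"
    and "t \<in> {0<..T} \<Longrightarrow> ((\<lambda>\<epsilon>. V \<epsilon> t) \<longlongrightarrow> E0 t (x t)) (at_right 0)"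
proof -
  have pos: "eventually (\<lambda>\<epsilon>. \<epsilon> > (0::real)) (at_right 0)" by (rule eventually_at_right_less)
  have M: "M \<ge> 0" using order_trans[OF norm_ge_zero bounded[of 1 0 0]] T by simp
  define S where "S = norm v0 + M"
  have S: "S \<ge> 0" using M by (simp add: S_def)
  have speed: "norm (V \<epsilon> t) \<le> S" if "\<epsilon> > 0" "t \<in> {0..T}" for \<epsilon> t
    using kinetic_path_speed[OF path[OF that(1)] that(1) bounded[OF that(1)] that(2)] by (simp add: S_def)
  have X_lip: "norm (X \<epsilon> t - X \<epsilon> s) \<le> S * \<bar>t - s\<bar>" if "\<epsilon> > 0" "s \<in> {0..T}" "t \<in> {0..T}" for \<epsilon> s t
    using kinetic_path_lipschitz[OF path[OF that(1)] that(1) bounded[OF that(1)] that(2,3)] by (simp add: S_def)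
  have x_der: "(x has_vector_derivative E0 t (x t)) (at t within {0..T})" if "t \<in> {0..T}" for t
    using macro that by (simp add: macro_path_def)
  have E0_bound: "norm (E0 t y) \<le> M" if "t \<in> {0..T}" for t y
    by (rule tendsto_upperbound[OF tendsto_norm[OF lim[OF that]]])
      (auto intro: eventually_mono[OF pos] bounded that)
  have x_lip: "norm (x t - x s) \<le> M * \<bar>t - s\<bar>" if "s \<in> {0..T}" "t \<in> {0..T}" for s t
  proof -
    have *: "norm (x b - x a) \<le> M * b - M * a" if "a \<le> b" "{a..b} \<subseteq> {0..T}" for a b
      by (rule norm_increment_le_of_derivative_le[OF that x_der])
        (use E0_bound that in \<open>auto intro!: derivative_eq_intros\<close>)
    show ?thesis
      using *[of s t] *[of t s] that
      by (cases "s \<le> t") (auto simp: norm_minus_commute algebra_simps)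
  qed
  have E_lip: "norm (E \<epsilon> t z - E \<epsilon> s y) \<le> L * norm (z - y) + \<kappa> * \<bar>t - s\<bar>"
    if "\<epsilon> > 0" "s \<in> {0..T}" "t \<in> {0..T}" for \<epsilon> s t y z
    using norm_triangle_ineq[of "E \<epsilon> t z - E \<epsilon> t y" "E \<epsilon> t y - E \<epsilon> s y"]
      lip[of \<epsilon> t z y] time[of \<epsilon> s t y] that by simp

  \<comment> \<open>Gronwall needs the error of the field along \<open>x\<close> to be small uniformly in time\<close>
  have unif: "uniform_limit {0..T} (\<lambda>\<epsilon> t. E \<epsilon> t (x t)) (\<lambda>t. E0 t (x t)) (at_right 0)"
  proof (rule uniform_limit_if_equi_lipschitz[where \<Lambda> = "L * M + \<kappa> + 1"])
    show "\<forall>\<^sub>F \<epsilon> in at_right 0. \<forall>s\<in>{0..T}. \<forall>t\<in>{0..T}.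
        dist (E \<epsilon> s (x s)) (E \<epsilon> t (x t)) \<le> (L * M + \<kappa> + 1) * dist s t"
    proof (rule eventually_mono[OF pos], intro ballI)
      fix \<epsilon> s t :: real assume *: "\<epsilon> > 0" "s \<in> {0..T}" "t \<in> {0..T}"
      have "norm (E \<epsilon> s (x s) - E \<epsilon> t (x t)) \<le> L * norm (x s - x t) + \<kappa> * \<bar>s - t\<bar>"
        using E_lip * by blast
      also have "\<dots> \<le> L * (M * \<bar>s - t\<bar>) + \<kappa> * \<bar>s - t\<bar>"
        using x_lip * L by (intro add_right_mono mult_left_mono) auto
      also have "\<dots> \<le> (L * M + \<kappa> + 1) * \<bar>s - t\<bar>" by (simp add: algebra_simps)
      finally show "dist (E \<epsilon> s (x s)) (E \<epsilon> t (x t)) \<le> (L * M + \<kappa> + 1) * dist s t"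
        by (simp add: dist_norm)
    qed
    show "0 < L * M + \<kappa> + 1" using L M \<kappa> by (simp add: add_nonneg_pos)
  qed (use lim in auto)

  \<comment> \<open>\<open>B\<close> collects the Gronwall factor for a source \<open>2 \<eta>\<close> and an initial error \<open>\<eta>\<close>, plus 1 for \<open>\<epsilon> V\<close>\<close>
  define B where "B = sqrt ((1 + 4 * T) * exp ((2 * L + 1) * T)) + 1"
  have B: "B > 0" using T by (simp add: B_def add_nonneg_pos)
  have close: "\<forall>\<^sub>F \<epsilon> in at_right 0. \<forall>t\<in>{0..T}. norm (X \<epsilon> t - x t) \<le> \<eta> * B" if \<eta>: "\<eta> > 0" for \<eta>
  proof -
    have small: "\<forall>\<^sub>F \<epsilon> in at_right 0. \<epsilon> * c < \<eta>" for c :: real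
    proof -
      have "((\<lambda>\<epsilon>. \<epsilon> * c) \<longlongrightarrow> 0 * c) (at_right 0)" by (intro tendsto_intros)
      then show ?thesis using \<eta> by (auto dest: order_tendstoD(2))
    qed
    show ?thesis
      using pos small[of S] small[of "L * S"] uniform_limitD[OF unif \<eta>]
    proof eventually_elim
      case (elim \<epsilon>)
      note D = kinetic_pathD[OF path[OF elim(1)]]
      define w where "w t = X \<epsilon> t + \<epsilon> *\<^sub>R V \<epsilon> t - x t" for t
      have Xw: "norm (X \<epsilon> t - x t) \<le> norm (w t) + \<epsilon> * S" if "t \<in> {0..T}" for t
      proof -
        have "norm (w t - \<epsilon> *\<^sub>R V \<epsilon> t) \<le> norm (w t) + norm (\<epsilon> *\<^sub>R V \<epsilon> t)"
          by (rule norm_triangle_ineq4)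
        also have "norm (\<epsilon> *\<^sub>R V \<epsilon> t) \<le> \<epsilon> * S"
          using speed[OF elim(1) that] elim(1) by (simp add: mult_left_mono)
        finally show ?thesis by (simp add: w_def)
      qed
      show ?case
      proof
        fix t assume t: "t \<in> {0..T}"
        have "(norm (w t))\<^sup>2 \<le> ((norm (w 0))\<^sup>2 + (2 * \<eta>)\<^sup>2 * t) * exp ((2 * L + 1) * t)"
        proof (rule gronwall_norm[OF _ _ _ _ t])
          fix s assume s: "s \<in> {0..T}"
          have "((\<lambda>t. \<epsilon> *\<^sub>R V \<epsilon> t) has_vector_derivative (E \<epsilon> s (X \<epsilon> s) - V \<epsilon> s)) (at s within {0..T})"
            using has_vector_derivative_scaleR[OF DERIV_const[of \<epsilon>] D(4)[OF s]] elim(1) by simp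
          from has_vector_derivative_diff[OF has_vector_derivative_add[OF D(3)[OF s] this] x_der[OF s]]
          show "(w has_vector_derivative E \<epsilon> s (X \<epsilon> s) - E0 s (x s)) (at s within {0..T})"
            by (simp add: w_def[abs_def])
          have "norm (E \<epsilon> s (X \<epsilon> s) - E0 s (x s))
              \<le> norm (E \<epsilon> s (X \<epsilon> s) - E \<epsilon> s (x s)) + norm (E \<epsilon> s (x s) - E0 s (x s))"
            using norm_triangle_ineq[of "E \<epsilon> s (X \<epsilon> s) - E \<epsilon> s (x s)" "E \<epsilon> s (x s) - E0 s (x s)"] by simp
          also have "\<dots> \<le> L * norm (X \<epsilon> s - x s) + \<eta>"
            using lip[OF elim(1) s] elim(4) s by (intro add_mono) (auto simp: dist_norm less_imp_le)
          also have "\<dots> \<le> L * (norm (w s) + \<epsilon> * S) + \<eta>"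
            using Xw[OF s] L by (intro add_right_mono mult_left_mono) auto
          also have "\<dots> \<le> L * norm (w s) + 2 * \<eta>"
            using elim(3) by (simp add: algebra_simps)
          finally show "norm (E \<epsilon> s (X \<epsilon> s) - E0 s (x s)) \<le> L * norm (w s) + 2 * \<eta>" .
        qed (use L \<eta> in auto)
        also have "\<dots> \<le> (\<eta>\<^sup>2 + (2 * \<eta>)\<^sup>2 * T) * exp ((2 * L + 1) * T)"
        proof (intro mult_mono add_mono power_mono)
          have "norm (w 0) = \<epsilon> * norm v0"
            using D(1,2) macro elim(1) by (simp add: w_def macro_path_def)
          also have "\<dots> \<le> \<epsilon> * S" using elim(1) M by (simp add: S_def)
          finally show "norm (w 0) \<le> \<eta>" using elim(2) by simp
        qed (use t L T \<eta> in auto)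
        also have "\<dots> = \<eta>\<^sup>2 * ((1 + 4 * T) * exp ((2 * L + 1) * T))"
          by (simp add: power2_eq_square algebra_simps)
        finally have "norm (w t) \<le> sqrt (\<eta>\<^sup>2 * ((1 + 4 * T) * exp ((2 * L + 1) * T)))"
          by (rule real_le_rsqrt)
        also have "\<dots> = \<eta> * (B - 1)" using \<eta> by (simp add: real_sqrt_mult B_def)
        finally show "norm (X \<epsilon> t - x t) \<le> \<eta> * B"
          using Xw[OF t] elim(2) by (simp add: algebra_simps)
      qed
    qed
  qed
  show X_lim: "((\<lambda>\<epsilon>. X \<epsilon> t) \<longlongrightarrow> x t) (at_right 0)" if "t \<in> {0..T}" for t
  proof (rule tendstoI)
    fix e :: real assume "e > 0"
    then have "e / (2 * B) > 0" using B by simp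
    from close[OF this] show "\<forall>\<^sub>F \<epsilon> in at_right 0. dist (X \<epsilon> t) (x t) < e"
    proof eventually_elim
      case (elim \<epsilon>)
      then have "norm (X \<epsilon> t - x t) \<le> e / 2" using B that by auto
      then show ?case using \<open>e > 0\<close> by (simp add: dist_norm)
    qed
  qed

  show "((\<lambda>\<epsilon>. V \<epsilon> t) \<longlongrightarrow> E0 t (x t)) (at_right 0)" if t: "t \<in> {0<..T}" for t
  proof -
    define \<Lambda> where "\<Lambda> = L * S + \<kappa>"
    have \<Lambda>: "\<Lambda> \<ge> 0" using L S \<kappa> by (simp add: \<Lambda>_def)
    have t': "t \<in> {0..T}" using t by simp
    have relax: "norm (V \<epsilon> t - E \<epsilon> t (X \<epsilon> t)) \<le> \<epsilon> * (S / t + \<Lambda>)" if \<epsilon>: "\<epsilon> > 0" for \<epsilon>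
    proof -
      let ?c = "E \<epsilon> t (X \<epsilon> t)"
      note D = kinetic_pathD[OF path[OF \<epsilon>]]
      have "norm (V \<epsilon> t - ?c) \<le> exp (- t / \<epsilon>) * norm (V \<epsilon> 0 - ?c) + 0 + \<Lambda> * \<epsilon>"
      proof (rule exponential_relaxation_bound[OF \<epsilon> D(4) _ t' \<Lambda> order_refl])
        fix s assume s: "s \<in> {0..t}"
        have "norm (E \<epsilon> s (X \<epsilon> s) - ?c) \<le> L * norm (X \<epsilon> s - X \<epsilon> t) + \<kappa> * \<bar>s - t\<bar>"
          by (rule E_lip[OF \<epsilon> t']) (use s t in auto)
        also have "\<dots> \<le> L * (S * \<bar>s - t\<bar>) + \<kappa> * \<bar>s - t\<bar>"
          using X_lip[OF \<epsilon>, of t s] s t L by (intro add_right_mono mult_left_mono) auto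
        finally show "norm (E \<epsilon> s (X \<epsilon> s) - ?c) \<le> 0 + \<Lambda> * (t - s)"
          using s by (simp add: \<Lambda>_def algebra_simps)
      qed
      \<comment> \<open>\<open>exp (- u) \<le> 1 / u\<close> suffices for convergence and keeps the bound linear in \<open>\<epsilon>\<close>\<close>
      moreover have "exp (- t / \<epsilon>) * norm (V \<epsilon> 0 - ?c) \<le> (\<epsilon> / t) * S"
      proof (rule mult_mono)
        have "t / \<epsilon> \<le> exp (t / \<epsilon>)" using exp_ge_add_one_self[of "t / \<epsilon>"] by linarith
        then have "1 / exp (t / \<epsilon>) \<le> 1 / (t / \<epsilon>)" using t \<epsilon> by (intro divide_left_mono) auto
        then show "exp (- t / \<epsilon>) \<le> \<epsilon> / t" by (simp add: exp_minus inverse_eq_divide)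
        show "norm (V \<epsilon> 0 - ?c) \<le> S"
          using norm_triangle_ineq4[of "V \<epsilon> 0" ?c] bounded[OF \<epsilon> t', of "X \<epsilon> t"] D(2) by (simp add: S_def)
      qed (use \<epsilon> t in auto)
      ultimately show ?thesis by (simp add: algebra_simps)
    qed
    have "((\<lambda>\<epsilon>. \<epsilon> * (S / t + \<Lambda>)) \<longlongrightarrow> 0 * (S / t + \<Lambda>)) (at_right 0)" by (intro tendsto_intros)
    then have V: "((\<lambda>\<epsilon>. V \<epsilon> t - E \<epsilon> t (X \<epsilon> t)) \<longlongrightarrow> 0) (at_right 0)"
      by (intro Lim_null_comparison[OF eventually_mono[OF pos relax]]) auto
    have "((\<lambda>\<epsilon>. L * norm (X \<epsilon> t - x t)) \<longlongrightarrow> L * norm (x t - x t)) (at_right 0)"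
      by (intro tendsto_intros X_lim t')
    then have "((\<lambda>\<epsilon>. E \<epsilon> t (X \<epsilon> t) - E \<epsilon> t (x t)) \<longlongrightarrow> 0) (at_right 0)"
      by (intro Lim_null_comparison[OF eventually_mono[OF pos lip[OF _ t']]]) auto
    from tendsto_add[OF tendsto_add[OF V this] lim[OF t', of "x t"]] show ?thesis by simp
  qed
qed

theorem theorem5p2:
  fixes T :: real
    and K :: "'a::euclidean_space \<Rightarrow> real" and gradK :: "'a \<Rightarrow> 'a"
    and f0 :: "('a \<times> 'a) measure"
    and f :: "real \<Rightarrow> real \<Rightarrow> ('a \<times> 'a) measure"
    and \<rho> :: "real \<Rightarrow> 'a measure"
    and x0 v0 :: 'a
    and x\<epsilon> v\<epsilon> :: "real \<Rightarrow> real \<Rightarrow> 'a"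
    and x v :: "real \<Rightarrow> 'a"
  assumes "T > 0"
    and "radial K" and "potential_gradient K gradK" and "gradK \<in> W_1_infty"
    and "f0 \<in> P1" and "compact (msupport f0)"
    and "\<And>\<epsilon>. \<epsilon> > 0 \<Longrightarrow> kinetic_solution gradK \<epsilon> T f0 (f \<epsilon>)"
    and "\<And>t. t \<in> {0..T} \<Longrightarrow> \<rho> t \<in> P1"
    and "\<And>t. t \<in> {0..T} \<Longrightarrow> ((\<lambda>\<epsilon>. W1 (marginal1 (f \<epsilon> t)) (\<rho> t)) \<longlongrightarrow> 0) (at_right 0)"
    and "(x0, v0) \<in> msupport f0"
    and "\<And>\<epsilon>. \<epsilon> > 0 \<Longrightarrow>
      kinetic_path \<epsilon> T (\<lambda>t y. - conv_measure gradK (marginal1 (f \<epsilon> t)) y) (x0, v0) (x\<epsilon> \<epsilon>) (v\<epsilon> \<epsilon>)"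
    and "macro_path T (\<lambda>t y. - conv_measure gradK (\<rho> t) y) x0 x"
    and "\<And>t. t \<in> {0..T} \<Longrightarrow> v t = - conv_measure gradK (\<rho> t) (x t)"
  shows "(\<forall>t\<in>{0..T}. ((\<lambda>\<epsilon>. x\<epsilon> \<epsilon> t) \<longlongrightarrow> x t) (at_right 0)) \<and>
    (\<forall>t\<in>{0<..T}. ((\<lambda>\<epsilon>. v\<epsilon> \<epsilon> t) \<longlongrightarrow> v t) (at_right 0))"
proof -
  have cont: "continuous_on UNIV gradK" using \<open>potential_gradient K gradK\<close>
    by (simp add: potential_gradient_def)
  obtain M where "\<And>y. norm (gradK y) \<le> M"
    using continuous_L_infty_imp_bounded[OF cont] \<open>gradK \<in> W_1_infty\<close>
    unfolding W_1_infty_def by blast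
  moreover obtain L where "L > 0" "\<And>y z. norm (gradK y - gradK z) \<le> L * norm (y - z)"
    using continuous_W_1_infty_imp_lipschitz[OF cont \<open>gradK \<in> W_1_infty\<close>] by blast
  ultimately interpret bounded_lipschitz_kernel gradK M L by unfold_locales auto
  note sol = assms(7) and f0 = \<open>f0 \<in> P1\<close>
  have marginal: "prob_space (marginal1 (f \<epsilon> t))" "sets (marginal1 (f \<epsilon> t)) = sets borel"
    if "\<epsilon> > 0" "t \<in> {0..T}" for \<epsilon> t
  proof -
    have "f \<epsilon> t \<in> P1" using sol[OF that(1)] that(2) unfolding kinetic_solution_def by blast
    from marginal1_P1[OF this]
    show "prob_space (marginal1 (f \<epsilon> t))" "sets (marginal1 (f \<epsilon> t)) = sets borel" .
  qed
  have M: "M \<ge> 0" by (rule order_trans[OF norm_ge_zero bounded[of 0]])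
  \<comment> \<open>the Lipschitz constant in time of the mean field, common to all \<open>\<epsilon>\<close>\<close>
  define \<kappa> where "\<kappa> = L * ((\<integral>z. norm (snd z) \<partial>f0) + M)"
  have \<kappa>: "\<kappa> \<ge> 0" using L_pos M by (simp add: \<kappa>_def)
  have bound: "norm (- conv_measure gradK (marginal1 (f \<epsilon> t)) y) \<le> M"
    if "\<epsilon> > 0" "t \<in> {0..T}" for \<epsilon> t y
    using conv_measure_bounded[OF marginal[OF that]] by simp
  have lip: "norm (- conv_measure gradK (marginal1 (f \<epsilon> t)) y
      - - conv_measure gradK (marginal1 (f \<epsilon> t)) z) \<le> L * norm (y - z)"
    if "\<epsilon> > 0" "t \<in> {0..T}" for \<epsilon> t y z
    using conv_measure_lipschitz[OF marginal[OF that], of z y] by (simp add: norm_minus_commute)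
  have time: "norm (- conv_measure gradK (marginal1 (f \<epsilon> t)) y
      - - conv_measure gradK (marginal1 (f \<epsilon> s)) y) \<le> \<kappa> * \<bar>t - s\<bar>"
    if "\<epsilon> > 0" "s \<in> {0..T}" "t \<in> {0..T}" for \<epsilon> s t y
    using kinetic_field_time_lipschitz[OF sol[OF that(1)] that(1) f0 that(3,2), of y]
    by (simp add: \<kappa>_def abs_minus_commute)
  have lim: "((\<lambda>\<epsilon>. - conv_measure gradK (marginal1 (f \<epsilon> t)) y) \<longlongrightarrow>
      - conv_measure gradK (\<rho> t) y) (at_right 0)" if "t \<in> {0..T}" for t y
    by (intro tendsto_minus conv_measure_tendsto assms(9) that
        eventually_mono[OF eventually_at_right_less[of 0]] marginal(1))
  note limits = small_inertia_limit[OF assms(11) assms(12) bound lip time lim L_pos \<kappa> \<open>T > 0\<close>]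
  show ?thesis
  proof (intro conjI ballI)
    show "((\<lambda>\<epsilon>. x\<epsilon> \<epsilon> t) \<longlongrightarrow> x t) (at_right 0)" if "t \<in> {0..T}" for t
      by (rule limits(1)) (use that in auto)
    show "((\<lambda>\<epsilon>. v\<epsilon> \<epsilon> t) \<longlongrightarrow> v t) (at_right 0)" if "t \<in> {0<..T}" for t
    proof -
      have "v t = - conv_measure gradK (\<rho> t) (x t)" using assms(13) that by simp
      moreover have "((\<lambda>\<epsilon>. v\<epsilon> \<epsilon> t) \<longlongrightarrow> - conv_measure gradK (\<rho> t) (x t)) (at_right 0)"
        by (rule limits(2)) (use that in auto)
      ultimately show ?thesis by simp
    qed
  qed
qed

end
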